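(* Let $k\geq 2$ be an integer and let $p=c/n$ with a constant $0<c<c_{k+1}$. Then for every integer $m\geq 4$, $$\lim_{n\to\infty}\Pr\left[m-k-2\leq M(n,c,m)\leq m-3\right]=1.$$
   Context: $G(n,p)$ is the Erdős–Rényi random graph on $n$ vertices with each edge present independently with probability $p$. For a graph $G$, $D(G)=\max_H \delta(H)$ over induced subgraphs $H$ of $G$, where $\delta$ is minimum degree. For $k\ge 2$, $c_k:=\sup\{c>0:\lim_{n\to\infty}\Pr[D(G(n,c/n))\geq k]=0\}$. $K_m$ is the complete graph on $m$ vertices. For graphs $G,H$, $\mathrm{Hom}(G,H)$ is the polyhedral complex whose cells are functions $\eta:V(G)\to 2^{V(H)}\setminus\{\varnothing\}$ with $\eta(x)\times\eta(y)\subseteq E(H)$ whenever $\{x,y\}\in E(G)$; the cell $\eta$ is a product of simplices of dimension $\sum_v(|\eta(v)|-1)$, with face relation $\eta\subseteq\tau$ iff $\eta(v)\subseteq\tau(v)$ for all $v$. For a space $X$, $\mathrm{conn}(X)$ is the largest $j$ such that $X$ is $j$-connected, where $X$ is $j$-connected if it is nonempty (for $j\ge-1$) and $\pi_i(X)$ vanishes for $0\le i\le j$. $M(n,c,m):=\mathrm{conn}[\mathrm{Hom}(G(n,c/n),K_m)]$. *)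

theory Defs
  imports "HOL-Analysis.Analysis"
begin

text \<open>Graphs on vertex set {0..<n} are given by their edge sets (sets of 2-subsets).\<close>

definition all_pairs :: "nat \<Rightarrow> nat set set" where
  "all_pairs n = {e. \<exists>u v. u < n \<and> v < n \<and> u \<noteq> v \<and> e = {u, v}}"

definition gnp_prob :: "nat \<Rightarrow> real \<Rightarrow> (nat set set \<Rightarrow> bool) \<Rightarrow> real" where
  "gnp_prob n p P =
     (\<Sum>E\<in>{E. E \<subseteq> all_pairs n \<and> P E}.
        p ^ card E * (1 - p) ^ (card (all_pairs n) - card E))"

definition deg_in :: "nat set set \<Rightarrow> nat set \<Rightarrow> nat \<Rightarrow> nat" where
  "deg_in E S v = card {u \<in> S. {u, v} \<in> E}"

definition Dmax :: "nat \<Rightarrow> nat set set \<Rightarrow> nat" where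
  "Dmax n E = Max {Min (deg_in E S ` S) | S. S \<subseteq> {0..<n} \<and> S \<noteq> {}}"

definition c_thr :: "nat \<Rightarrow> ereal" where
  "c_thr k = Sup {ereal c | c. c > 0 \<and>
      (\<lambda>n. gnp_prob n (c / real n) (\<lambda>E. Dmax n E \<ge> k)) \<longlonglongrightarrow> 0}"

text \<open>Standard realisation inside the product of simplices \<Prod>_{v} \<Delta>^{V(K_m)}:
  a point assigns to each vertex v<n a probability vector x(v,-) on the colours {0..<m};
  its support is the cell eta(v). The cell condition for K_m (no loops, all other pairs
  adjacent) says adjacent vertices have disjoint supports.\<close>
definition hom_real :: "nat \<Rightarrow> nat set set \<Rightarrow> nat \<Rightarrow> (nat \<times> nat \<Rightarrow> real) set" where
  "hom_real n E m = {x.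
      (\<forall>v i. x (v, i) \<noteq> 0 \<longrightarrow> v < n \<and> i < m) \<and>
      (\<forall>v i. x (v, i) \<ge> 0) \<and>
      (\<forall>v<n. (\<Sum>i<m. x (v, i)) = 1) \<and>
      (\<forall>u w i. {u, w} \<in> E \<longrightarrow> \<not> (x (u, i) \<noteq> 0 \<and> x (w, i) \<noteq> 0))}"

definition sph :: "nat \<Rightarrow> (nat \<Rightarrow> real) set" where
  "sph i = {y. (\<forall>k>i. y k = 0) \<and> (\<Sum>k\<le>i. (y k)\<^sup>2) = 1}"

text \<open>pi_i(X) vanishes: every map S^i \<rightarrow> X is null-homotopic
  (for i = 0 together with nonemptiness this is path-connectedness).\<close>
definition pi_trivial :: "'a::topological_space set \<Rightarrow> nat \<Rightarrow> bool" where
  "pi_trivial X i = (\<forall>f. continuous_map (top_of_set (sph i)) (top_of_set X) f \<longrightarrow>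
       (\<exists>c. homotopic_with (\<lambda>_. True) (top_of_set (sph i)) (top_of_set X) f (\<lambda>_. c)))"

definition j_connected :: "'a::topological_space set \<Rightarrow> int \<Rightarrow> bool" where
  "j_connected X j = ((j \<ge> -1 \<longrightarrow> X \<noteq> {}) \<and> (\<forall>i::nat. int i \<le> j \<longrightarrow> pi_trivial X i))"

definition conn :: "'a::topological_space set \<Rightarrow> ereal" where
  "conn X = Sup {ereal (real_of_int j) | j. j_connected X j}"

definition Mconn :: "nat \<Rightarrow> nat set set \<Rightarrow> nat \<Rightarrow> ereal" where
  "Mconn n E m = conn (hom_real n E m)"

end

(* With high probability the graph has an isolated edge (second moment) and every subgraph has a
   vertex of degree at most k (the event D >= k+1 is increasing, so its probability at c/n is
   dominated by that at some c'/n with c < c' < c_{k+1}).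

   An isolated edge {a,b} makes the sphere S^(m-2), which is Hom(K_2,K_m) up to homotopy, a retract
   of Hom(G,K_m): a point x is sent to the direction of x(a,-) - x(b,-).  Hence pi_(m-2) is nonzero.

   For the lower bound, remove a vertex v with a set W of at most k neighbours.  Given a sphere of
   dimension i <= m-k-2 in Hom(G,K_m), fill its restriction to G-v by a disc D.  The colour v can
   take at a point of D is unobstructed unless the supports of the neighbours cover all m colours.
   Shrinking the supports never leaves the complex, and a generic perturbation of the weights makes
   the near-maximal colours of the neighbours satisfy sum_w (|supp_w| - 1) <= dim D, so that at most
   i + 1 + k < m colours are in use.  Genericity comes from a counting argument over a fine grid, so
   neither cellular approximation nor a dimension fixed by a type is needed.  The new sphere is
   joined to the old one by straight lines. *)
theory Submission
  imports Defs "HOL-Homology.Homology" "HOL-Real_Asymp.Real_Asymp"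
begin

section \<open>Generic shifts\<close>

text \<open>A uniform upper bound \<open>q\<close> on the box-counting dimension:
  \<open>O(N^q)\<close> sets of diameter \<open>O(1/N)\<close> cover \<open>D\<close> at every
  scale. Counting cells makes sense in \<open>nat => real\<close>, where no type carries the
  dimension; one \<open>C\<close> serves for both number and diameter.\<close>

definition box_dim_le :: "'a::metric_space set \<Rightarrow> nat \<Rightarrow> bool" where
  "box_dim_le D q \<longleftrightarrow> (\<exists>C::nat. \<forall>N\<ge>1. \<exists>\<Q>. finite \<Q> \<and> card \<Q> \<le> C * N ^ q \<and> D \<subseteq> \<Union>\<Q> \<and>
     (\<forall>Q\<in>\<Q>. \<forall>s\<in>Q. \<forall>t\<in>Q. dist s t \<le> real C / real N))"

lemma box_dim_le_singleton: "box_dim_le {a} 0"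
  unfolding box_dim_le_def
  by (intro exI[of _ 1] allI impI exI[of _ "{{a}}"]) auto

text \<open>The product metric is a sum of distances truncated at 1 with weights
  \<open>(1/2)^n\<close>, and these weights add up to 2.\<close>

lemma dist_fun_le:
  fixes x y :: "'i::countable \<Rightarrow> 'b::metric_space"
  assumes "\<And>i. dist (x i) (y i) \<le> d"
  shows "dist x y \<le> 2 * d"
proof -
  have s: "summable (\<lambda>n. (1/2)^n * d)"
    by (intro summable_mult2) simp
  have "dist x y \<le> suminf (\<lambda>n. (1/2)^n * d)"
    unfolding dist_fun_def
  proof (rule suminf_le)
    show "summable (\<lambda>n. (1 / 2) ^ n * min (dist (x (from_nat n)) (y (from_nat n))) 1)"
      by (rule summable_comparison_test'[of "\<lambda>n. (1/2)^n * d"]) (auto simp: s assms min.coboundedI1)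
  qed (auto simp: s assms min.coboundedI1)
  also have "\<dots> = 2 * d"
    by (subst suminf_mult2[symmetric]) (auto simp: suminf_geometric)
  finally show ?thesis .
qed

text \<open>All these numbers lie in a window of length \<open>2 * R\<close> that begins at the
  least of them. The bound does not depend on the centre \<open>x\<close>, so it is uniform over all
  cells and all rounded values below.\<close>

lemma card_nat_near_le:
  fixes x R :: real
  assumes "R \<ge> 0"
  shows "finite {a::nat. \<bar>real a - x\<bar> \<le> R}" "card {a::nat. \<bar>real a - x\<bar> \<le> R} \<le> nat \<lceil>2 * R\<rceil> + 1"
proof -
  let ?S = "{a::nat. \<bar>real a - x\<bar> \<le> R}"
  have "finite ?S \<and> card ?S \<le> nat \<lceil>2 * R\<rceil> + 1"
  proof (cases "?S = {}")
    case False
    define a0 where "a0 = (LEAST a. a \<in> ?S)"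
    have a0: "a0 \<in> ?S"
      using False unfolding a0_def by (metis (mono_tags, lifting) LeastI equals0I)
    have "?S \<subseteq> {a0..a0 + nat \<lceil>2 * R\<rceil>}"
    proof
      fix a assume a: "a \<in> ?S"
      then have "a0 \<le> a" unfolding a0_def by (rule Least_le)
      moreover have "real a \<le> real a0 + 2 * R" using a a0 by (auto simp: abs_le_iff)
      then have "int a \<le> int a0 + \<lceil>2 * R\<rceil>" by linarith
      ultimately show "a \<in> {a0..a0 + nat \<lceil>2 * R\<rceil>}" by auto
    qed
    then show ?thesis
      using card_mono[of "{a0..a0 + nat \<lceil>2 * R\<rceil>}" ?S] by (auto intro: finite_subset)
  qed auto
  then show "finite ?S" "card ?S \<le> nat \<lceil>2 * R\<rceil> + 1" by auto
qed

text \<open>A shift \<open>\<theta>\<close> on the grid of mesh \<open>1/N\<close> that violates the conclusion is determined, up to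
  boundedly many choices, by one of \<open>O(N^q)\<close> small cells of \<open>D\<close> and the values \<open>M w\<close> rounded to the
  grid. This makes \<open>O(N^(q + card W))\<close> bad shifts out of \<open>N^m\<close>.\<close>

lemma generic_shift:
  fixes D :: "'a::metric_space set" and W :: "'w set" and \<sigma> :: "'w \<Rightarrow> nat \<Rightarrow> 'a \<Rightarrow> real"
  assumes box: "box_dim_le D q" and W: "finite W" "q + card W < m"
    and L: "L \<ge> 0" and lip: "\<And>w i s t. w \<in> W \<Longrightarrow> i < m \<Longrightarrow> s \<in> D \<Longrightarrow> t \<in> D \<Longrightarrow> \<bar>\<sigma> w i s - \<sigma> w i t\<bar> \<le> L * dist s t"
  obtains \<theta> :: "nat \<Rightarrow> real" and \<delta> :: real
  where "\<delta> > 0" and "\<And>i. i < m \<Longrightarrow> 0 \<le> \<theta> i \<and> \<theta> i \<le> 1"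
    and "\<And>t M. t \<in> D \<Longrightarrow> (\<And>w. w \<in> W \<Longrightarrow> 0 \<le> M w \<and> M w \<le> real A) \<Longrightarrow>
           \<exists>i<m. \<forall>w\<in>W. \<delta> < \<bar>M w - \<sigma> w i t - \<theta> i\<bar>"
proof -
  obtain C :: nat where C: "\<And>N. N \<ge> 1 \<Longrightarrow> \<exists>\<Q>. finite \<Q> \<and> card \<Q> \<le> C * N ^ q \<and> D \<subseteq> \<Union>\<Q> \<and>
     (\<forall>Q\<in>\<Q>. \<forall>s\<in>Q. \<forall>t\<in>Q. dist s t \<le> real C / real N)"
    using box unfolding box_dim_le_def by blast
  \<comment> \<open>After scaling by \<open>N\<close> the error has three parts: 1 from the
    tolerance \<open>1 / N\<close>, 1 from rounding \<open>M w\<close>, and \<open>L * C\<close>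
    from replacing a point by the base point of its cell.\<close>
  define R where "R = 2 + L * real C"
  have R0: "R \<ge> 0" using L by (simp add: R_def)
  define K where "K = nat \<lceil>2 * R\<rceil> + 1"
  \<comment> \<open>\<open>K'\<close> collects the factors of the count free of \<open>N\<close>:
    cells, ranges of the rounded values, and for each of the \<open>m\<close> coordinates a choice
    of \<open>w\<close> and of a grid point near it. Any \<open>N > K'\<close> makes
    \<open>K' * N^(q + card W)\<close> smaller than \<open>N^m\<close>, as
    \<open>q + card W < m\<close>.\<close>
  define K' where "K' = C * (A + 1) ^ card W * (card W * K) ^ m"
  define N where "N = K' + 1"
  have N: "N \<ge> 1" "K' < N" by (auto simp: N_def)
  obtain \<Q> where \<Q>: "finite \<Q>" "card \<Q> \<le> C * N ^ q" "D \<subseteq> \<Union>\<Q>"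
    and diam: "\<And>Q s t. Q \<in> \<Q> \<Longrightarrow> s \<in> Q \<Longrightarrow> t \<in> Q \<Longrightarrow> dist s t \<le> real C / real N"
    using C[OF N(1)] by (elim exE conjE) (rule that, auto)
  \<comment> \<open>The Lipschitz bound holds on \<open>D\<close> only, and cells may stick out of
    \<open>D\<close>, so the base point is taken in the intersection. Its default value for a cell
    missing \<open>D\<close> is harmless, since such a cell never contains a point \<open>t\<close>
    of \<open>D\<close>.\<close>
  define base where "base Q = (SOME t. t \<in> Q \<inter> D)" for Q
  define near where "near Q w i b = {a::nat. \<bar>real a - (real b - real N * \<sigma> w i (base Q))\<bar> \<le> R}" for Q w i b
  have near_fin: "finite (near Q w i b)" and near_card: "card (near Q w i b) \<le> K" for Q w i b
    using card_nat_near_le[OF R0] unfolding near_def K_def by auto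
  define Bad where "Bad = (\<Union>Q\<in>\<Q>. \<Union>b\<in>PiE W (\<lambda>_. {..A * N}). PiE {..<m} (\<lambda>i. \<Union>w\<in>W. near Q w i (b w)))"
  have pie: "card (PiE {..<m} (\<lambda>i. \<Union>w\<in>W. near Q w i (b w))) \<le> (card W * K) ^ m" for Q b
  proof -
    have "card (\<Union>w\<in>W. near Q w i (b w)) \<le> card W * K" for i
    proof -
      have "card (\<Union>w\<in>W. near Q w i (b w)) \<le> (\<Sum>w\<in>W. card (near Q w i (b w)))"
        by (rule card_UN_le[OF W(1)])
      also have "\<dots> \<le> (\<Sum>w\<in>W. K)" by (intro sum_mono near_card)
      finally show ?thesis by simp
    qed
    then have "(\<Prod>i<m. card (\<Union>w\<in>W. near Q w i (b w))) \<le> (\<Prod>i<m. card W * K)"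
      by (intro prod_mono) auto
    then show ?thesis by (subst card_PiE) auto
  qed
  have "card Bad \<le> (\<Sum>Q\<in>\<Q>. card (\<Union>b\<in>PiE W (\<lambda>_. {..A * N}). PiE {..<m} (\<lambda>i. \<Union>w\<in>W. near Q w i (b w))))"
    unfolding Bad_def by (rule card_UN_le[OF \<Q>(1)])
  also have "\<dots> \<le> (\<Sum>Q\<in>\<Q>. ((A + 1) * N) ^ card W * (card W * K) ^ m)"
  proof (rule sum_mono)
    fix Q assume "Q \<in> \<Q>"
    have finW: "finite (PiE W (\<lambda>_. {..A * N}))" using W(1) by (intro finite_PiE) auto
    have "card (\<Union>b\<in>PiE W (\<lambda>_. {..A * N}). PiE {..<m} (\<lambda>i. \<Union>w\<in>W. near Q w i (b w)))
       \<le> (\<Sum>b\<in>PiE W (\<lambda>_. {..A * N}). card (PiE {..<m} (\<lambda>i. \<Union>w\<in>W. near Q w i (b w))))"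
      by (rule card_UN_le[OF finW])
    also have "\<dots> \<le> (\<Sum>b\<in>PiE W (\<lambda>_. {..A * N}). (card W * K) ^ m)"
      by (intro sum_mono pie)
    also have "\<dots> = (A * N + 1) ^ card W * (card W * K) ^ m"
      using W(1) by (simp add: card_PiE)
    also have "\<dots> \<le> ((A + 1) * N) ^ card W * (card W * K) ^ m"
      using N(1) by (intro mult_right_mono power_mono) auto
    finally show "card (\<Union>b\<in>PiE W (\<lambda>_. {..A * N}). PiE {..<m} (\<lambda>i. \<Union>w\<in>W. near Q w i (b w)))
      \<le> ((A + 1) * N) ^ card W * (card W * K) ^ m" .
  qed
  also have "\<dots> = card \<Q> * (((A + 1) * N) ^ card W * (card W * K) ^ m)" by simp
  also have "\<dots> \<le> C * N ^ q * (((A + 1) * N) ^ card W * (card W * K) ^ m)"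
    by (intro mult_right_mono \<Q>(2)) auto
  also have "\<dots> = K' * N ^ (q + card W)"
    by (simp only: K'_def power_mult_distrib power_add ac_simps)
  also have "\<dots> < N * N ^ (q + card W)"
    using N by (intro mult_strict_right_mono) auto
  also have "\<dots> = N ^ Suc (q + card W)" by simp
  also have "\<dots> \<le> N ^ m"
    using W(2) N(1) by (intro power_increasing) auto
  also have "\<dots> = card (PiE {..<m} (\<lambda>_. {..<N}))"
    by (simp add: card_PiE)
  finally have less: "card Bad < card (PiE {..<m} (\<lambda>_. {..<N}))" .
  have "finite Bad"
    unfolding Bad_def using W(1) \<Q>(1) near_fin by (intro finite_UN_I finite_PiE) auto
  with less have "\<not> PiE {..<m} (\<lambda>_. {..<N}) \<subseteq> Bad"
    using card_mono[of Bad] by (meson leD)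
  then obtain a where a: "a \<in> PiE {..<m} (\<lambda>_. {..<N})" "a \<notin> Bad" by auto
  define \<theta> where "\<theta> i = real (a i) / real N" for i
  show thesis
  proof (rule that[of "1 / real N" \<theta>])
    show "0 \<le> \<theta> i \<and> \<theta> i \<le> 1" if "i < m" for i
      using a(1) that N(1) by (auto simp: \<theta>_def PiE_iff less_imp_le)
    show "\<exists>i<m. \<forall>w\<in>W. 1 / real N < \<bar>M w - \<sigma> w i t - \<theta> i\<bar>"
      if t: "t \<in> D" and M: "\<And>w. w \<in> W \<Longrightarrow> 0 \<le> M w \<and> M w \<le> real A" for t M
    proof (rule ccontr)
      assume "\<not> ?thesis"
      then have H: "\<And>i. i < m \<Longrightarrow> \<exists>w\<in>W. \<bar>M w - \<sigma> w i t - \<theta> i\<bar> \<le> 1 / real N"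
        by (meson not_le)
      obtain Q where Q: "Q \<in> \<Q>" "t \<in> Q" using t \<Q>(3) by auto
      have "base Q \<in> Q \<inter> D" unfolding base_def using Q(2) t by (intro someI[of "\<lambda>t. t \<in> Q \<inter> D" t]) auto
      then have bQ: "base Q \<in> Q" "base Q \<in> D" by auto
      define b where "b = restrict (\<lambda>w. nat \<lfloor>M w * real N\<rfloor>) W"
      have bW: "b \<in> PiE W (\<lambda>_. {..A * N})"
      proof (rule PiE_I)
        fix w assume w: "w \<in> W"
        have "M w * real N \<le> real A * real N" using M[OF w] by (intro mult_right_mono) auto
        then have "\<lfloor>M w * real N\<rfloor> \<le> int (A * N)"
          by (metis floor_mono floor_of_nat of_nat_mult)
        then show "b w \<in> {..A * N}" using w by (auto simp: b_def nat_le_iff)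
      qed (auto simp: b_def)
      have bM: "\<bar>real (b w) - M w * real N\<bar> \<le> 1" if "w \<in> W" for w
      proof -
        have "0 \<le> M w * real N" using M[OF that] by auto
        then show ?thesis using that by (simp add: b_def) linarith
      qed
      have "a \<in> PiE {..<m} (\<lambda>i. \<Union>w\<in>W. near Q w i (b w))"
      proof (rule PiE_I)
        fix i assume i: "i \<in> {..<m}"
        then obtain w where w: "w \<in> W" "\<bar>M w - \<sigma> w i t - \<theta> i\<bar> \<le> 1 / real N" using H by auto
        have "\<bar>real N * (M w - \<sigma> w i t - \<theta> i)\<bar> \<le> real N * (1 / real N)"
          unfolding abs_mult using w(2) by (intro mult_mono) auto
        then have 1: "\<bar>M w * real N - real N * \<sigma> w i t - real (a i)\<bar> \<le> 1"
          using N(1) by (simp add: \<theta>_def algebra_simps)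
        have "\<bar>\<sigma> w i t - \<sigma> w i (base Q)\<bar> \<le> L * dist t (base Q)"
          using i w(1) t bQ by (intro lip) auto
        also have "\<dots> \<le> L * (real C / real N)"
          using diam[OF Q(1) Q(2) bQ(1)] L by (intro mult_left_mono)
        finally have "real N * \<bar>\<sigma> w i t - \<sigma> w i (base Q)\<bar> \<le> real N * (L * (real C / real N))"
          by (intro mult_left_mono) auto
        then have "\<bar>real N * (\<sigma> w i t - \<sigma> w i (base Q))\<bar> \<le> L * real C"
          using N(1) by (simp add: abs_mult)
        then have 2: "\<bar>real N * \<sigma> w i t - real N * \<sigma> w i (base Q)\<bar> \<le> L * real C"
          by (simp add: algebra_simps)
        have "\<bar>real (a i) - (real (b w) - real N * \<sigma> w i (base Q))\<bar> \<le> R"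
          using 1 2 bM[OF w(1)] unfolding R_def by linarith
        then show "a i \<in> (\<Union>w\<in>W. near Q w i (b w))" using w(1) by (auto simp: near_def)
      qed (use a(1) in auto)
      then have "a \<in> Bad" unfolding Bad_def using Q(1) bW by blast
      with a(2) show False by simp
    qed
  qed (use N(1) in auto)
qed

text \<open>The approximation is the inf-convolution of \<open>\<phi>\<close> with a steep cone.\<close>

lemma lipschitz_below_approx:
  fixes \<phi> :: "'a::metric_space \<Rightarrow> real"
  assumes "compact D" "continuous_on D \<phi>" "\<And>t. t \<in> D \<Longrightarrow> 0 \<le> \<phi> t \<and> \<phi> t \<le> B" "\<epsilon> > 0"
  obtains \<sigma> L where "L \<ge> 0" "\<And>t. t \<in> D \<Longrightarrow> 0 \<le> \<sigma> t \<and> \<sigma> t \<le> \<phi> t \<and> \<phi> t \<le> \<sigma> t + \<epsilon>"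
    "\<And>s t. s \<in> D \<Longrightarrow> t \<in> D \<Longrightarrow> \<bar>\<sigma> s - \<sigma> t\<bar> \<le> L * dist s t"
proof (cases "D = {}")
  case True
  then show thesis using that[of 0 \<phi>] by auto
next
  case False
  obtain d where d: "d > 0" "\<And>s t. s \<in> D \<Longrightarrow> t \<in> D \<Longrightarrow> dist s t < d \<Longrightarrow> \<bar>\<phi> s - \<phi> t\<bar> < \<epsilon>"
    using compact_uniformly_continuous[OF assms(2,1)] assms(4)
    unfolding uniformly_continuous_on_def dist_real_def by metis
  have B: "B \<ge> 0" using False assms(3) by fastforce
  \<comment> \<open>With this slope the cone rises by at least \<open>B\<close> beyond distance
    \<open>d\<close>, so points that far away cannot push the infimum below \<open>\<phi> t\<close>;
    nearer points change \<open>\<phi>\<close> by less than \<open>\<epsilon>\<close>.\<close>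
  define L where "L = B / d"
  have L: "L \<ge> 0" using B d by (simp add: L_def)
  define \<sigma> where "\<sigma> t = (INF s\<in>D. \<phi> s + L * dist t s)" for t
  have bdd: "bdd_below ((\<lambda>s. \<phi> s + L * dist t s) ` D)" for t
    using assms(3) L by (intro bdd_belowI[of _ 0]) (auto intro!: add_nonneg_nonneg)
  have le: "\<sigma> t \<le> \<phi> s + L * dist t s" if "s \<in> D" for s t
    unfolding \<sigma>_def using bdd that by (rule cINF_lower)
  have ge: "x \<le> \<sigma> t" if "\<And>s. s \<in> D \<Longrightarrow> x \<le> \<phi> s + L * dist t s" for x t
    unfolding \<sigma>_def using False that by (rule cINF_greatest)
  have one: "\<sigma> s \<le> \<sigma> t + L * dist s t" if "s \<in> D" "t \<in> D" for s t
  proof -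
    have "\<sigma> s - L * dist s t \<le> \<sigma> t"
    proof (rule ge)
      fix r assume r: "r \<in> D"
      have "L * dist s r \<le> L * (dist s t + dist t r)"
        using L by (intro mult_left_mono dist_triangle)
      then show "\<sigma> s - L * dist s t \<le> \<phi> r + L * dist t r"
        using le[OF r, of s] by (simp add: algebra_simps)
    qed
    then show ?thesis by simp
  qed
  show thesis
  proof (rule that[of L \<sigma>])
    show "\<bar>\<sigma> s - \<sigma> t\<bar> \<le> L * dist s t" if "s \<in> D" "t \<in> D" for s t
      using one[OF that] one[OF that(2,1)] by (simp add: dist_commute abs_le_iff)
    show "0 \<le> \<sigma> t \<and> \<sigma> t \<le> \<phi> t \<and> \<phi> t \<le> \<sigma> t + \<epsilon>" if t: "t \<in> D" for t
    proof (intro conjI)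
      show "0 \<le> \<sigma> t" using assms(3) L by (intro ge add_nonneg_nonneg) auto
      show "\<sigma> t \<le> \<phi> t" using le[OF t, of t] by simp
      have "\<phi> t - \<epsilon> \<le> \<sigma> t"
      proof (rule ge)
        fix s assume s: "s \<in> D"
        show "\<phi> t - \<epsilon> \<le> \<phi> s + L * dist t s"
        proof (cases "dist t s < d")
          case True
          have "L * dist t s \<ge> 0" using L by simp
          then show ?thesis using d(2)[OF t s True] by linarith
        next
          case False
          then have "B * d \<le> B * dist t s" using B by (intro mult_left_mono) auto
          then have "B \<le> L * dist t s" using d(1) by (simp add: L_def field_simps)
          then show ?thesis using assms(3)[OF t] assms(3)[OF s] assms(4) by linarith
        qed
      qed
      then show "\<phi> t \<le> \<sigma> t + \<epsilon>" by simp
    qed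
  qed (rule L)
qed

lemma continuous_on_Max:
  fixes f :: "'i \<Rightarrow> 'a::topological_space \<Rightarrow> 'b::linorder_topology"
  assumes "finite I" "I \<noteq> {}" "\<And>i. i \<in> I \<Longrightarrow> continuous_on D (f i)"
  shows "continuous_on D (\<lambda>t. Max ((\<lambda>i. f i t) ` I))"
  using assms
proof (induction I rule: finite_ne_induct)
  case (insert i I)
  have "continuous_on D (\<lambda>t. max (f i t) (Max ((\<lambda>i. f i t) ` I)))"
    by (intro continuous_on_max insert.IH insert.prems) auto
  then show ?case using insert.hyps by simp
qed auto

section \<open>Spheres and discs\<close>

text \<open>The index is that of the bounding sphere \<open>sph i\<close>, so the dimension is
  \<open>i + 1\<close>.\<close>

definition disc :: "nat \<Rightarrow> (nat \<Rightarrow> real) set" where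
  "disc i = {y. (\<forall>k>i. y k = 0) \<and> (\<Sum>k\<le>i. (y k)\<^sup>2) \<le> 1}"

lemma disc_abs_le: "y \<in> disc i \<Longrightarrow> \<bar>y k\<bar> \<le> 1"
proof (cases "k \<le> i")
  case True
  assume y: "y \<in> disc i"
  have "(y k)\<^sup>2 \<le> (\<Sum>k\<le>i. (y k)\<^sup>2)" using True by (intro member_le_sum) auto
  also have "\<dots> \<le> 1" using y by (simp add: disc_def)
  finally show ?thesis by (simp add: abs_square_le_1)
qed (simp add: disc_def)

lemma sph_subset_disc: "sph i \<subseteq> disc i"
  by (auto simp: sph_def disc_def)

text \<open>A closed subset of the cube \<open>[-1, 1]^nat\<close>, which is compact by
  Tychonoff.\<close>

lemma compact_disc: "compact (disc i)"
proof -
  have "compactin (product_topology (\<lambda>_. euclidean) UNIV) (PiE UNIV (\<lambda>_::nat. {-1..1::real}))"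
    by (subst compactin_PiE) (auto simp: compactin_euclidean_iff)
  then have c: "compact (PiE UNIV (\<lambda>_::nat. {-1..1::real}))"
    by (simp add: euclidean_product_topology compactin_euclidean_iff)
  have "disc i = (\<Inter>k\<in>{i<..}. {y. y k = 0}) \<inter> {y. (\<Sum>k\<le>i. (y k)\<^sup>2) \<le> 1}"
    by (auto simp: disc_def)
  also have "closed \<dots>"
    by (intro closed_Int closed_INT ballI closed_Collect_eq closed_Collect_le continuous_intros) auto
  finally have "compact (PiE UNIV (\<lambda>_::nat. {-1..1::real}) \<inter> disc i)"
    using c by (rule compact_Int_closed[rotated])
  moreover have "disc i \<subseteq> PiE UNIV (\<lambda>_::nat. {-1..1::real})"
    using disc_abs_le by (fastforce simp: PiE_iff abs_le_iff)
  ultimately show ?thesis by (simp add: Int_absorb1)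
qed

text \<open>Cubes of side \<open>1 / N\<close> in the first \<open>i + 1\<close> coordinates: at
  most \<open>2 * N + 1 <= 3 * N\<close> intervals are needed in each, and the cells have diameter
  at most \<open>2 / N\<close>. The constant \<open>3 ^ (i + 1)\<close> covers both.\<close>

lemma box_dim_le_disc: "box_dim_le (disc i) (i + 1)"
  unfolding box_dim_le_def
proof (intro exI[of _ "3 ^ (i + 1)"] allI impI)
  fix N :: nat assume N: "N \<ge> 1"
  \<comment> \<open>Adding 1 moves the coordinates into \<open>[0, 2]\<close>, so that
    \<open>nat\<close> of the floor loses nothing.\<close>
  define Q where "Q b = {y \<in> disc i. \<forall>k\<le>i. nat \<lfloor>(y k + 1) * real N\<rfloor> = b k}" for b
  define B where "B = PiE {..i} (\<lambda>_. {..2 * N})"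
  have finB: "finite B" by (auto simp: B_def intro!: finite_PiE)
  have nn: "0 \<le> (y k + 1) * real N" "(y k + 1) * real N \<le> 2 * real N" if "y \<in> disc i" for y k
    using disc_abs_le[OF that, of k] by (auto simp: abs_le_iff intro!: mult_right_mono)
  show "\<exists>\<Q>. finite \<Q> \<and> card \<Q> \<le> 3 ^ (i + 1) * N ^ (i + 1) \<and> disc i \<subseteq> \<Union>\<Q> \<and>
          (\<forall>Q\<in>\<Q>. \<forall>s\<in>Q. \<forall>t\<in>Q. dist s t \<le> real (3 ^ (i + 1)) / real N)"
  proof (intro exI[of _ "Q ` B"] conjI ballI)
    show "finite (Q ` B)" using finB by simp
    have "card (Q ` B) \<le> card B" using finB by (rule card_image_le)
    also have "\<dots> = (2 * N + 1) ^ (i + 1)" by (simp add: B_def card_PiE)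
    also have "\<dots> \<le> (3 * N) ^ (i + 1)" using N by (intro power_mono) auto
    finally show "card (Q ` B) \<le> 3 ^ (i + 1) * N ^ (i + 1)" by (simp only: power_mult_distrib)
    show "disc i \<subseteq> \<Union>(Q ` B)"
    proof
      fix y assume y: "y \<in> disc i"
      define b where "b = restrict (\<lambda>k. nat \<lfloor>(y k + 1) * real N\<rfloor>) {..i}"
      have "nat \<lfloor>(y k + 1) * real N\<rfloor> \<le> 2 * N" for k
        using nn[OF y, of k] by linarith
      then have "b \<in> B" by (auto simp: b_def B_def)
      moreover have "y \<in> Q b" using y by (auto simp: Q_def b_def)
      ultimately show "y \<in> \<Union>(Q ` B)" by auto
    qed
    fix P s t assume "P \<in> Q ` B" and st: "s \<in> P" "t \<in> P"
    then obtain b where P: "P = Q b" by auto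
    have "dist (s k) (t k) \<le> 1 / real N" for k
    proof (cases "k \<le> i")
      case True
      have "nat \<lfloor>(s k + 1) * real N\<rfloor> = nat \<lfloor>(t k + 1) * real N\<rfloor>"
        using st True by (auto simp: P Q_def)
      then have "\<bar>(s k + 1) * real N - (t k + 1) * real N\<bar> \<le> 1"
        using nn[of s k] nn[of t k] st by (simp add: P Q_def) linarith
      then have "\<bar>(s k - t k) * real N\<bar> \<le> 1" by (simp add: algebra_simps)
      then have "\<bar>s k - t k\<bar> * real N \<le> 1" by (simp add: abs_mult)
      then show ?thesis using N by (simp add: dist_real_def pos_le_divide_eq)
    next
      case False
      then show ?thesis using st by (simp add: P Q_def disc_def)
    qed
    then have "dist s t \<le> 2 * (1 / real N)" by (rule dist_fun_le)
    also have "\<dots> \<le> real (3 ^ (i + 1)) / real N"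
    proof -
      have "(1::real) \<le> 3 ^ i" by simp
      then have "(2::real) \<le> 3 ^ (i + 1)" unfolding power_add power_one_right by linarith
      then show ?thesis by (simp add: divide_right_mono)
    qed
    finally show "dist s t \<le> real (3 ^ (i + 1)) / real N" .
  qed
qed

section \<open>Null-homotopies and fillings of spheres\<close>

lemma sph_nonempty: "sph i \<noteq> {}"
proof -
  have "(\<lambda>k. if k = 0 then 1 else 0) \<in> sph i"
    by (auto simp: sph_def if_distrib[of "\<lambda>x. x\<^sup>2"] cong: if_cong)
  then show ?thesis by auto
qed

lemma sph_normalise:
  assumes "\<And>k. k > i \<Longrightarrow> y k = 0" "(\<Sum>k\<le>i. (y k)\<^sup>2) \<noteq> 0"
  shows "(\<lambda>k. y k / sqrt (\<Sum>k\<le>i. (y k)\<^sup>2)) \<in> sph i"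
  using assms by (auto simp: sph_def power_divide sum_nonneg simp flip: sum_divide_distrib)

text \<open>The homotopy is run along the radius: at radius \<open>r\<close> between
  \<open>1/2\<close> and 1 it is taken at time \<open>2 - 2 * r\<close>. The inner half of the disc
  goes to \<open>c\<close>, which keeps the division by \<open>r\<close> away from the
  origin.\<close>

lemma nullhomotopic_extends_to_disc:
  fixes X :: "'a::topological_space set"
  assumes "homotopic_with (\<lambda>_. True) (top_of_set (sph i)) (top_of_set X) f (\<lambda>_. c)"
  obtains F where "continuous_on (disc i) F" "F ` disc i \<subseteq> X" "\<And>y. y \<in> sph i \<Longrightarrow> F y = f y"
proof -
  obtain h :: "real \<times> (nat \<Rightarrow> real) \<Rightarrow> 'a"
    where h: "continuous_on ({0..1} \<times> sph i) h" "h ` ({0..1} \<times> sph i) \<subseteq> X"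
      "\<And>y. h (0, y) = f y" "\<And>y. h (1, y) = c"
    using assms unfolding homotopic_with_def by (auto simp: image_subset_iff_funcset)
  define r where "r y = sqrt (\<Sum>k\<le>i. (y k)\<^sup>2)" for y :: "nat \<Rightarrow> real"
  define F where "F y = (if r y \<le> 1/2 then c else h (2 - 2 * r y, \<lambda>k. y k / r y))" for y
  have r: "continuous_on T r" for T
    unfolding r_def by (intro continuous_intros continuous_on_product_then_coordinatewise[OF continuous_on_id])
  have r1: "r y \<le> 1" if "y \<in> disc i" for y
    using that by (simp add: r_def disc_def)
  have norm: "(\<lambda>k. y k / r y) \<in> sph i" if "y \<in> disc i" "r y \<ge> 1/2" for y
    unfolding r_def using that by (intro sph_normalise) (auto simp: disc_def r_def)
  show thesis
  proof (rule that[of F])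
    show "continuous_on (disc i) F"
      unfolding F_def
    proof (rule continuous_on_cases_le)
      have "continuous_on {t \<in> disc i. 1/2 \<le> r t} (\<lambda>y. (2 - 2 * r y, \<lambda>k. y k / r y))"
        by (intro continuous_intros r continuous_on_coordinatewise_then_product
            continuous_on_product_then_coordinatewise[OF continuous_on_id]) auto
      then show "continuous_on {t \<in> disc i. 1/2 \<le> r t} (\<lambda>y. h (2 - 2 * r y, \<lambda>k. y k / r y))"
        by (rule continuous_on_compose2[OF h(1)]) (use norm r1 in auto)
      show "c = h (2 - 2 * r y, \<lambda>k. y k / r y)" if "y \<in> disc i" "r y = 1/2" for y
        by (simp add: that h)
    qed (auto intro: r)
    show "F ` disc i \<subseteq> X"
    proof (intro image_subsetI)
      fix y assume y: "y \<in> disc i"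
      \<comment> \<open>That \<open>c\<close> lies in \<open>X\<close> is seen from the end of the
        homotopy at any point of the sphere.\<close>
      obtain z where "z \<in> sph i" using sph_nonempty by auto
      then have "h (1, z) \<in> X" using h(2) by (intro subsetD[OF h(2)] imageI) auto
      moreover have "h (2 - 2 * r y, \<lambda>k. y k / r y) \<in> X" if "\<not> r y \<le> 1/2"
        using norm[OF y] r1[OF y] that by (intro subsetD[OF h(2)] imageI) auto
      ultimately show "F y \<in> X" by (auto simp: F_def h)
    qed
    show "F y = f y" if "y \<in> sph i" for y
      using that by (simp add: F_def h r_def sph_def)
  qed
qed

lemma homotopic_straight_line:
  fixes f g :: "'a::topological_space \<Rightarrow> 'b \<Rightarrow> real"
  assumes "continuous_on T f" "continuous_on T g"
    and "\<And>t u. t \<in> T \<Longrightarrow> 0 \<le> u \<Longrightarrow> u \<le> 1 \<Longrightarrow> (\<lambda>p. (1 - u) * f t p + u * g t p) \<in> X"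
  shows "homotopic_with (\<lambda>_. True) (top_of_set T) (top_of_set X) f g"
  unfolding homotopic_with_def
proof (intro exI[of _ "\<lambda>(u, t) p. (1 - u) * f t p + u * g t p"] conjI)
  have "continuous_on ({0..1} \<times> T) (\<lambda>z. f (snd z) p)" "continuous_on ({0..1} \<times> T) (\<lambda>z. g (snd z) p)" for p
    by (rule continuous_on_compose2[OF continuous_on_product_then_coordinatewise[OF assms(1)] continuous_on_snd[OF continuous_on_id]]
        continuous_on_compose2[OF continuous_on_product_then_coordinatewise[OF assms(2)] continuous_on_snd[OF continuous_on_id]]; auto)+
  then have "continuous_on ({0..1} \<times> T) (\<lambda>(u, t) p. (1 - u) * f t p + u * g t p)"
    unfolding case_prod_beta
    by (intro continuous_on_coordinatewise_then_product continuous_intros) auto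
  then show "continuous_map (prod_topology (top_of_set {0..1}) (top_of_set T)) (top_of_set X)
     (\<lambda>(u, t) p. (1 - u) * f t p + u * g t p)"
    using assms(3) by (auto simp: image_subset_iff)
qed auto

section \<open>Adding a vertex of small degree\<close>

text \<open>An arbitrary vertex set permits the removal of vertices one at a time with
  \<open>E\<close> unchanged: weights off \<open>S\<close> are zero, so edges leaving
  \<open>S\<close> impose no condition.\<close>

definition hom_on :: "nat set \<Rightarrow> nat set set \<Rightarrow> nat \<Rightarrow> (nat \<times> nat \<Rightarrow> real) set" where
  "hom_on S E m = {x.
      (\<forall>v i. x (v, i) \<noteq> 0 \<longrightarrow> v \<in> S \<and> i < m) \<and>
      (\<forall>v i. x (v, i) \<ge> 0) \<and>
      (\<forall>v\<in>S. (\<Sum>i<m. x (v, i)) = 1) \<and>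
      (\<forall>u w i. {u, w} \<in> E \<longrightarrow> \<not> (x (u, i) \<noteq> 0 \<and> x (w, i) \<noteq> 0))}"

lemma hom_real_eq_hom_on: "hom_real n E m = hom_on {0..<n} E m"
  by (auto simp: hom_real_def hom_on_def)

lemma hom_onI:
  assumes "\<And>v i. x (v, i) \<noteq> 0 \<Longrightarrow> v \<in> S \<and> i < m" "\<And>v i. x (v, i) \<ge> 0"
    "\<And>v. v \<in> S \<Longrightarrow> (\<Sum>i<m. x (v, i)) = 1"
    "\<And>u w i. {u, w} \<in> E \<Longrightarrow> x (u, i) \<noteq> 0 \<Longrightarrow> x (w, i) \<noteq> 0 \<Longrightarrow> False"
  shows "x \<in> hom_on S E m"
  using assms unfolding hom_on_def by blast

lemma hom_onD:
  assumes "x \<in> hom_on S E m"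
  shows "x (v, i) \<noteq> 0 \<Longrightarrow> v \<in> S" "x (v, i) \<noteq> 0 \<Longrightarrow> i < m" "x (v, i) \<ge> 0"
    "v \<in> S \<Longrightarrow> (\<Sum>i<m. x (v, i)) = 1"
    "{u, w} \<in> E \<Longrightarrow> x (u, i) \<noteq> 0 \<Longrightarrow> x (w, i) \<noteq> 0 \<Longrightarrow> False"
  using assms unfolding hom_on_def by blast+

lemma hom_on_le_1:
  assumes "x \<in> hom_on S E m" shows "x (v, i) \<le> 1"
proof (cases "x (v, i) = 0")
  case False
  then have "i < m" "v \<in> S" using hom_onD[OF assms] by auto
  then have "x (v, i) \<le> (\<Sum>i<m. x (v, i))"
    using hom_onD(3)[OF assms] by (intro member_le_sum) auto
  then show ?thesis using hom_onD(4)[OF assms \<open>v \<in> S\<close>] by simp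
qed auto

text \<open>The support of the mixture lies in the union of the two supports. A conflict along an
  edge inside \<open>x\<close> or inside \<open>y\<close> is impossible, so only a crossed conflict
  has to be excluded by \<open>disj\<close>.\<close>

lemma hom_on_mix:
  assumes x: "x \<in> hom_on S E m" and y: "y \<in> hom_on S E m" and u: "0 \<le> u" "u \<le> 1"
    and disj: "\<And>a b i. {a, b} \<in> E \<Longrightarrow> x (a, i) \<noteq> 0 \<Longrightarrow> y (b, i) \<noteq> 0 \<Longrightarrow> False"
  shows "(\<lambda>p. (1 - u) * x p + u * y p) \<in> hom_on S E m"
proof (rule hom_onI)
  show "(\<Sum>i<m. (1 - u) * x (v, i) + u * y (v, i)) = 1" if "v \<in> S" for v
    using hom_onD(4)[OF x that] hom_onD(4)[OF y that]
    by (simp add: sum.distrib flip: sum_distrib_left)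
  show "0 \<le> (1 - u) * x (v, i) + u * y (v, i)" for v i
    using hom_onD(3)[OF x] hom_onD(3)[OF y] u by auto
  show "v \<in> S \<and> i < m" if "(1 - u) * x (v, i) + u * y (v, i) \<noteq> 0" for v i
    using that hom_onD(1,2)[OF x, of v i] hom_onD(1,2)[OF y, of v i]
    by (cases "x (v, i) = 0"; cases "y (v, i) = 0") auto
  show False if "{a, b} \<in> E" "(1 - u) * x (a, i) + u * y (a, i) \<noteq> 0" "(1 - u) * x (b, i) + u * y (b, i) \<noteq> 0" for a b i
  proof -
    have "{b, a} \<in> E" using that(1) by (simp add: insert_commute)
    moreover have "x (a, i) \<noteq> 0 \<or> y (a, i) \<noteq> 0" "x (b, i) \<noteq> 0 \<or> y (b, i) \<noteq> 0" using that by auto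
    ultimately show False
      using that(1) hom_onD(5)[OF x, of a b i] hom_onD(5)[OF y, of a b i] disj[of a b i] disj[of b a i] by blast
  qed
qed

text \<open>After the shift, a neighbour \<open>w\<close> keeps the colours whose gap to the maximum \<open>M w\<close> is below \<open>\<delta>\<close>,
  and \<open>v\<close> uses those whose gap exceeds \<open>\<delta>\<close> for all neighbours. The factor \<open>4 * m\<close> ensures that
  the maximum exceeds all approximation errors, so that no colour outside the old support appears.\<close>

lemma extend_vertex:
  fixes D :: "'a::metric_space set" and F' :: "'a \<Rightarrow> nat \<times> nat \<Rightarrow> real"
  assumes D: "compact D" "box_dim_le D q"
    and W: "W = {u \<in> S. {u, v} \<in> E}" "finite W" "q + card W < m"
    and v: "v \<notin> S" "{v} \<notin> E"
    and F': "continuous_on D F'" "F' ` D \<subseteq> hom_on S E m"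
  obtains F where "continuous_on D F" "F ` D \<subseteq> hom_on (insert v S) E m"
    "\<And>t u i. t \<in> D \<Longrightarrow> u \<noteq> v \<Longrightarrow> F t (u, i) \<noteq> 0 \<Longrightarrow> F' t (u, i) \<noteq> 0"
proof -
  have F'in: "F' t \<in> hom_on S E m" if "t \<in> D" for t using F'(2) that by auto
  have m: "m > 0" using W(3) by simp
  \<comment> \<open>Approximating from below is what matters here: wherever the approximation is
    positive, so is the original weight. The error 1 is small against the scale
    \<open>4 * m\<close>.\<close>
  have "\<exists>\<sigma> L. L \<ge> 0 \<and> (\<forall>t\<in>D. 0 \<le> \<sigma> t \<and> \<sigma> t \<le> 4 * real m * F' t z \<and> 4 * real m * F' t z \<le> \<sigma> t + 1) \<and>
      (\<forall>s\<in>D. \<forall>t\<in>D. \<bar>\<sigma> s - \<sigma> t\<bar> \<le> L * dist s t)" for z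
  proof -
    have c: "continuous_on D (\<lambda>t. 4 * real m * F' t z)"
      by (intro continuous_on_mult continuous_on_const continuous_on_product_then_coordinatewise[OF F'(1)])
    have "0 \<le> 4 * real m * F' t z \<and> 4 * real m * F' t z \<le> 4 * real m" if "t \<in> D" for t
    proof -
      obtain u i where z: "z = (u, i)" by fastforce
      have "0 \<le> F' t z" "F' t z \<le> 1"
        using hom_onD(3)[OF F'in[OF that], of u i] hom_on_le_1[OF F'in[OF that], of u i] by (auto simp: z)
      then show ?thesis by (simp add: mult_left_le)
    qed
    from lipschitz_below_approx[OF D(1) c this zero_less_one] show ?thesis by metis
  qed
  then obtain \<sigma> Lf where Lf: "\<And>z. Lf z \<ge> 0"
    and \<sigma>: "\<And>z t. t \<in> D \<Longrightarrow> 0 \<le> \<sigma> z t" "\<And>z t. t \<in> D \<Longrightarrow> \<sigma> z t \<le> 4 * real m * F' t z"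
      "\<And>z t. t \<in> D \<Longrightarrow> 4 * real m * F' t z \<le> \<sigma> z t + 1"
    and lip: "\<And>z s t. s \<in> D \<Longrightarrow> t \<in> D \<Longrightarrow> \<bar>\<sigma> z s - \<sigma> z t\<bar> \<le> Lf z * dist s t"
    by metis
  have cont\<sigma>: "continuous_on D (\<sigma> z)" for z
  proof -
    have "(Lf z)-lipschitz_on D (\<sigma> z)"
      using lip Lf by (intro lipschitz_onI) (auto simp: dist_real_def)
    then show ?thesis by (rule lipschitz_on_continuous_on)
  qed
  define L where "L = (\<Sum>z\<in>W \<times> {..<m}. Lf z)"
  have L: "L \<ge> 0" using Lf by (auto simp: L_def sum_nonneg)
  have lip': "\<bar>\<sigma> (w, i) s - \<sigma> (w, i) t\<bar> \<le> L * dist s t" if "w \<in> W" "i < m" "s \<in> D" "t \<in> D" for w i s t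
  proof -
    have "Lf (w, i) \<le> L" unfolding L_def using that W(2) Lf by (intro member_le_sum) auto
    then have "Lf (w, i) * dist s t \<le> L * dist s t" by (intro mult_right_mono) auto
    then show ?thesis using lip[OF that(3,4), of "(w, i)"] by linarith
  qed
  \<comment> \<open>The bound \<open>4 * m + 1\<close> is that for the scaled weights, at most
    \<open>4 * m\<close>, plus a shift of at most 1.\<close>
  obtain \<theta> \<delta>0 where \<delta>0: "\<delta>0 > 0" and \<theta>: "\<And>i. i < m \<Longrightarrow> 0 \<le> \<theta> i \<and> \<theta> i \<le> 1"
    and gen: "\<And>t M. t \<in> D \<Longrightarrow> (\<And>w. w \<in> W \<Longrightarrow> 0 \<le> M w \<and> M w \<le> real (4 * m + 1)) \<Longrightarrow>
           \<exists>i<m. \<forall>w\<in>W. \<delta>0 < \<bar>M w - \<sigma> (w, i) t - \<theta> i\<bar>"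
  proof (rule generic_shift[where \<sigma> = "\<lambda>w i. \<sigma> (w, i)" and A = "4 * m + 1", OF D(2) W(2,3) L])
    fix \<theta> \<delta>0
    assume "0 < \<delta>0" "\<And>i. i < m \<Longrightarrow> 0 \<le> \<theta> i \<and> \<theta> i \<le> 1"
      "\<And>t M. t \<in> D \<Longrightarrow> (\<And>w. w \<in> W \<Longrightarrow> 0 \<le> M w \<and> M w \<le> real (4 * m + 1)) \<Longrightarrow>
           \<exists>i<m. \<forall>w\<in>W. \<delta>0 < \<bar>M w - \<sigma> (w, i) t - \<theta> i\<bar>"
    then show thesis by (rule that)
  qed (rule lip')
  \<comment> \<open>The cap 1 protects the supports: a colour with gap below \<open>\<delta>\<close>
    has \<open>\<sigma>\<close> greater than \<open>3 - 1 - 1\<close>, because the maximum is at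
    least 3 and the shift at most 1.\<close>
  define \<delta> where "\<delta> = min \<delta>0 1"
  have \<delta>: "\<delta> > 0" "\<delta> \<le> \<delta>0" "\<delta> \<le> 1" using \<delta>0 by (auto simp: \<delta>_def)
  define M where "M w t = Max ((\<lambda>i. \<sigma> (w, i) t + \<theta> i) ` {..<m})" for w t
  define gap where "gap w i t = M w t - \<sigma> (w, i) t - \<theta> i" for w i t
  define \<psi> where "\<psi> w i t = max 0 (\<delta> - gap w i t)" for w i t
  \<comment> \<open>The product vanishes as soon as one neighbour has gap at most
    \<open>\<delta>\<close>, hence wherever some \<open>\<psi> w i\<close> is positive. For empty
    \<open>W\<close> it is 1, which makes the colours of \<open>v\<close> uniformly
    distributed.\<close>
  define s where "s i t = (\<Prod>w\<in>W. max 0 (gap w i t - \<delta>))" for i t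
  have contM: "continuous_on D (M w)" for w
    unfolding M_def[abs_def] using m
    by (intro continuous_on_Max continuous_intros cont\<sigma>) auto
  have contgap: "continuous_on D (gap w i)" for w i
    unfolding gap_def by (intro continuous_intros contM cont\<sigma>)
  have cont\<psi>: "continuous_on D (\<psi> w i)" for w i
    unfolding \<psi>_def by (intro continuous_intros contgap)
  have conts: "continuous_on D (s i)" for i
    unfolding s_def by (intro continuous_intros contgap)
  have Mge: "\<sigma> (w, i) t + \<theta> i \<le> M w t" if "i < m" for w i t
    unfolding M_def using that by (intro Max_ge) auto
  have Mex: "\<exists>i<m. M w t = \<sigma> (w, i) t + \<theta> i" for w t
  proof -
    have "M w t \<in> (\<lambda>i. \<sigma> (w, i) t + \<theta> i) ` {..<m}"
      unfolding M_def using m by (intro Max_in) auto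
    then show ?thesis by auto
  qed
  have gap0: "gap w i t \<ge> 0" if "i < m" for w i t
    using Mge[OF that, of w t] by (simp add: gap_def)
  have Mle: "0 \<le> M w t \<and> M w t \<le> real (4 * m + 1)" if t: "t \<in> D" for w t
  proof -
    obtain i where i: "i < m" "M w t = \<sigma> (w, i) t + \<theta> i" using Mex by blast
    have "4 * real m * F' t (w, i) \<le> 4 * real m"
      using hom_on_le_1[OF F'in[OF t], of w i] by (intro mult_left_le) auto
    moreover have "real (4 * m + 1) = 4 * real m + 1" by simp
    ultimately show ?thesis using i(2) \<sigma>(1,2)[OF t, of "(w, i)"] \<theta>[OF i(1)] by linarith
  qed
  \<comment> \<open>By averaging, some colour of \<open>w\<close> has weight at least
    \<open>1 / m\<close>; its scaled weight is at least 4, hence its approximation at least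
    3.\<close>
  have M3: "M w t \<ge> 3" if t: "t \<in> D" and w: "w \<in> W" for w t
  proof (rule ccontr)
    assume less: "\<not> M w t \<ge> 3"
    have "4 * real m * F' t (w, i) < 4" if "i < m" for i
      using Mge[OF that, of w t] \<sigma>(3)[OF t, of "(w, i)"] \<theta>[OF that] less by simp
    then have "(\<Sum>i<m. 4 * real m * F' t (w, i)) < (\<Sum>i<m. 4)"
      using m by (intro sum_strict_mono) auto
    moreover have "(\<Sum>i<m. F' t (w, i)) = 1" using hom_onD(4)[OF F'in[OF t]] w W(1) by auto
    ultimately show False by (simp flip: sum_distrib_left)
  qed
  have \<psi>_supp: "F' t (w, i) \<noteq> 0" if t: "t \<in> D" and w: "w \<in> W" and i: "i < m" and nz: "\<psi> w i t \<noteq> 0" for t w i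
  proof -
    have "gap w i t < \<delta>" using nz by (auto simp: \<psi>_def max_def split: if_splits)
    then have "\<sigma> (w, i) t > 0" using M3[OF t w] \<theta>[OF i] \<delta>(3) by (simp add: gap_def)
    then show ?thesis using \<sigma>(2)[OF t, of "(w, i)"] by auto
  qed
  have \<psi>0: "\<psi> w i t \<ge> 0" and s0: "s i t \<ge> 0" for w i t
    by (auto simp: \<psi>_def s_def intro!: prod_nonneg)
  define Z where "Z w t = (\<Sum>i<m. \<psi> w i t)" for w t
  define Zs where "Zs t = (\<Sum>i<m. s i t)" for t
  have Z: "Z w t > 0" for w t
  proof -
    obtain i where i: "i < m" "M w t = \<sigma> (w, i) t + \<theta> i" using Mex by blast
    then have "\<psi> w i t > 0" using \<delta>(1) by (simp add: \<psi>_def gap_def)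
    moreover have "\<psi> w i t \<le> Z w t" unfolding Z_def using i(1) \<psi>0 by (intro member_le_sum) auto
    ultimately show ?thesis by linarith
  qed
  have Zs: "Zs t > 0" if t: "t \<in> D" for t
  proof -
    obtain i where i: "i < m" "\<And>w. w \<in> W \<Longrightarrow> \<delta>0 < \<bar>gap w i t\<bar>"
      using gen[OF t, of "\<lambda>w. M w t"] Mle[OF t] unfolding gap_def by blast
    have "gap w i t - \<delta> > 0" if "w \<in> W" for w
      using i(2)[OF that] gap0[OF i(1), of w t] \<delta>(2) by simp
    then have "s i t > 0" unfolding s_def by (intro prod_pos) auto
    moreover have "s i t \<le> Zs t" unfolding Zs_def using i(1) s0 by (intro member_le_sum) auto
    ultimately show ?thesis by linarith
  qed
  define F where "F t z = (case z of (u, i) \<Rightarrow>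
      if i < m \<and> u \<in> W then \<psi> u i t / Z u t else if i < m \<and> u = v then s i t / Zs t else F' t (u, i))" for t z
  have vW: "v \<notin> W" using W(1) v(1) by auto
  have FW: "F t (u, i) = \<psi> u i t / Z u t" if "i < m" "u \<in> W" for t u i
    using that by (simp add: F_def)
  have Fv: "F t (v, i) = s i t / Zs t" if "i < m" for t i
    using that vW by (simp add: F_def)
  have Fother: "F t (u, i) = F' t (u, i)" if "u \<notin> W \<and> u \<noteq> v \<or> \<not> i < m" for t u i
    using that by (auto simp: F_def)
  have Fsupp: "F' t (u, i) \<noteq> 0" if "t \<in> D" "u \<noteq> v" "F t (u, i) \<noteq> 0" for t u i
    using that \<psi>_supp[of t u i] FW[of i u t] Fother[of u i t] by (cases "u \<in> W \<and> i < m") auto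
  show thesis
  proof (rule that[of F])
    show "continuous_on D F"
    proof (rule continuous_on_coordinatewise_then_product)
      fix z :: "nat \<times> nat"
      obtain u i where z: "z = (u, i)" by fastforce
      have "continuous_on D (Z u)" "continuous_on D Zs"
        unfolding Z_def Zs_def by (intro continuous_intros cont\<psi> conts)+
      then have 1: "continuous_on D (\<lambda>t. \<psi> u i t / Z u t)" "continuous_on D (\<lambda>t. s i t / Zs t)"
        using Z Zs by (auto intro!: continuous_intros cont\<psi> conts simp: less_imp_neq[symmetric])
      have 2: "continuous_on D (\<lambda>t. F' t (u, i))"
        using F'(1) by (rule continuous_on_product_then_coordinatewise)
      show "continuous_on D (\<lambda>t. F t z)"
        unfolding F_def z prod.case using 1 2
        by (cases "i < m"; cases "u \<in> W"; cases "u = v") simp_all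
    qed
    show "F ` D \<subseteq> hom_on (insert v S) E m"
    proof (intro image_subsetI hom_onI)
      fix t assume t: "t \<in> D"
      note F't = F'in[OF t]
      have vz: "F' t (v, i) = 0" for i using hom_onD(1)[OF F't] v(1) by auto
      show "u \<in> insert v S \<and> i < m" if "F t (u, i) \<noteq> 0" for u i
      proof (cases "u = v")
        case True
        then show ?thesis using that Fother[of v i t] vz by auto
      next
        case False
        then show ?thesis using Fsupp[OF t False that] hom_onD(1,2)[OF F't] by auto
      qed
      show "F t (u, i) \<ge> 0" for u i
        using \<psi>0 s0 Z[of u t] Zs[OF t] hom_onD(3)[OF F't] by (simp add: F_def less_imp_le)
      show "(\<Sum>i<m. F t (u, i)) = 1" if u: "u \<in> insert v S" for u
      proof -
        consider "u = v" | "u \<in> W" | "u \<in> S" "u \<notin> W" "u \<noteq> v" using u by blast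
        then show ?thesis
        proof cases
          case 1
          then have "(\<Sum>i<m. F t (u, i)) = (\<Sum>i<m. s i t / Zs t)" using Fv by simp
          also have "\<dots> = Zs t / Zs t" unfolding Zs_def by (rule sum_divide_distrib[symmetric])
          finally show ?thesis using Zs[OF t] by simp
        next
          case 2
          then have "(\<Sum>i<m. F t (u, i)) = (\<Sum>i<m. \<psi> u i t / Z u t)" using FW by simp
          also have "\<dots> = Z u t / Z u t" unfolding Z_def by (rule sum_divide_distrib[symmetric])
          finally show ?thesis using Z[of u t] by simp
        next
          case 3
          then show ?thesis using Fother hom_onD(4)[OF F't] by simp
        qed
      qed
      have edge_v: False if e: "{u, v} \<in> E" and nz: "F t (u, i) \<noteq> 0" "F t (v, i) \<noteq> 0" for u i
      proof -
        have uv: "u \<noteq> v" using e v(2) by auto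
        have nz': "F' t (u, i) \<noteq> 0" using Fsupp[OF t uv nz(1)] .
        have i: "i < m" and uS: "u \<in> S" using hom_onD(1,2)[OF F't nz'] by auto
        have u: "u \<in> W" using e uS W(1) by auto
        have "\<psi> u i t \<noteq> 0" using nz(1) FW[OF i u] by auto
        then have "max 0 (gap u i t - \<delta>) = 0" by (auto simp: \<psi>_def max_def split: if_splits)
        then have "s i t = 0" unfolding s_def using u W(2) by (meson prod_zero)
        then show False using nz(2) Fv[OF i] by simp
      qed
      show False if "{u, w} \<in> E" "F t (u, i) \<noteq> 0" "F t (w, i) \<noteq> 0" for u w i
      proof (cases "u = v \<or> w = v")
        case True
        then show False using edge_v[of u i] edge_v[of w i] that by (auto simp: insert_commute)
      next
        case False
        then show False using Fsupp[OF t] hom_onD(5)[OF F't that(1)] that(2,3) by blast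
      qed
    qed
    show "\<And>t u i. t \<in> D \<Longrightarrow> u \<noteq> v \<Longrightarrow> F t (u, i) \<noteq> 0 \<Longrightarrow> F' t (u, i) \<noteq> 0" by (rule Fsupp)
  qed
qed

text \<open>The sphere is filled without \<open>v\<close> by a disc of dimension
  \<open>i + 1\<close>, and \<open>v\<close> is then put back over the whole disc. On the boundary
  the result \<open>F\<close> differs from \<open>f\<close>, but only by shrinking supports off
  \<open>v\<close> and by recolouring \<open>v\<close>, so it can be joined to
  \<open>f\<close>.\<close>

lemma pi_trivial_insert_vertex:
  assumes W: "W = {u \<in> S. {u, v} \<in> E}" "finite W" "i + 1 + card W < m"
    and v: "v \<notin> S" "{v} \<notin> E"
    and pi: "pi_trivial (hom_on S E m) i"
  shows "pi_trivial (hom_on (insert v S) E m) i"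
  unfolding pi_trivial_def
proof (intro allI impI)
  fix f :: "(nat \<Rightarrow> real) \<Rightarrow> nat \<times> nat \<Rightarrow> real"
  let ?X = "hom_on (insert v S) E m"
  assume "continuous_map (top_of_set (sph i)) (top_of_set ?X) f"
  then have f: "continuous_on (sph i) f" "\<And>t. t \<in> sph i \<Longrightarrow> f t \<in> ?X" by auto
  note fc = continuous_on_product_then_coordinatewise[OF f(1)]
  define f' where "f' t z = (if fst z = v then 0 else f t z)" for t z
  have f'c: "continuous_on (sph i) f'"
  proof (rule continuous_on_coordinatewise_then_product)
    show "continuous_on (sph i) (\<lambda>t. f' t z)" for z
      using fc[of z] by (cases "fst z = v") (simp_all add: f'_def)
  qed
  have f'X: "f' t \<in> hom_on S E m" if t: "t \<in> sph i" for t
  proof (rule hom_onI)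
    show "u \<in> S \<and> j < m" if "f' t (u, j) \<noteq> 0" for u j
      using that hom_onD(1,2)[OF f(2)[OF t], of u j] by (auto simp: f'_def split: if_splits)
    show "(\<Sum>j<m. f' t (u, j)) = 1" if "u \<in> S" for u
      using that v(1) hom_onD(4)[OF f(2)[OF t], of u] by (cases "u = v") (auto simp: f'_def)
    show "f' t (u, j) \<ge> 0" for u j using hom_onD(3)[OF f(2)[OF t]] by (simp add: f'_def)
    show False if "{u, w} \<in> E" "f' t (u, j) \<noteq> 0" "f' t (w, j) \<noteq> 0" for u w j
      using that hom_onD(5)[OF f(2)[OF t], of u w j] by (auto simp: f'_def split: if_splits)
  qed
  have "continuous_map (top_of_set (sph i)) (top_of_set (hom_on S E m)) f'"
    using f'c f'X by auto
  then obtain c where "homotopic_with (\<lambda>_. True) (top_of_set (sph i)) (top_of_set (hom_on S E m)) f' (\<lambda>_. c)"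
    using pi unfolding pi_trivial_def by blast
  then obtain F' where F': "continuous_on (disc i) F'" "F' ` disc i \<subseteq> hom_on S E m"
    "\<And>t. t \<in> sph i \<Longrightarrow> F' t = f' t"
    by (rule nullhomotopic_extends_to_disc) blast
  obtain F where F: "continuous_on (disc i) F" "F ` disc i \<subseteq> ?X"
    "\<And>t u j. t \<in> disc i \<Longrightarrow> u \<noteq> v \<Longrightarrow> F t (u, j) \<noteq> 0 \<Longrightarrow> F' t (u, j) \<noteq> 0"
    using extend_vertex[OF compact_disc box_dim_le_disc W v F'(1,2)] by blast
  have Fc: "continuous_on (sph i) F" using F(1) sph_subset_disc by (rule continuous_on_subset)
  have FX: "F t \<in> ?X" if "t \<in> disc i" for t using F(2) that by auto
  have Fs: "F t \<in> ?X" if "t \<in> sph i" for t using FX sph_subset_disc that by auto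
  have Fsupp: "f t (u, j) \<noteq> 0" if "t \<in> sph i" "u \<noteq> v" "F t (u, j) \<noteq> 0" for t u j
    using F(3)[of t u j] that sph_subset_disc F'(3) by (auto simp: f'_def)
  \<comment> \<open>The old colours of \<open>v\<close> combined with the new colours elsewhere.
    Passing through \<open>f1\<close> separates two changes that might conflict: from
    \<open>f\<close> to \<open>f1\<close> supports only shrink, and from \<open>f1\<close> to
    \<open>F\<close> only \<open>v\<close> moves while its neighbours stay compatible with both its
    old and its new colours.\<close>
  define f1 where "f1 t z = (if fst z = v then f t z else F t z)" for t z
  have f1c: "continuous_on (sph i) f1"
  proof (rule continuous_on_coordinatewise_then_product)
    show "continuous_on (sph i) (\<lambda>t. f1 t z)" for z
      using fc[of z] continuous_on_product_then_coordinatewise[OF Fc, of z]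
      by (cases "fst z = v") (simp_all add: f1_def)
  qed
  have f1supp: "f t (u, j) \<noteq> 0" if "t \<in> sph i" "f1 t (u, j) \<noteq> 0" for t u j
    using that Fsupp by (auto simp: f1_def split: if_splits)
  have f1X: "f1 t \<in> ?X" if t: "t \<in> sph i" for t
  proof (rule hom_onI)
    show "u \<in> insert v S \<and> j < m" if "f1 t (u, j) \<noteq> 0" for u j
      using f1supp[OF t that] hom_onD(1,2)[OF f(2)[OF t], of u j] by auto
    show "(\<Sum>j<m. f1 t (u, j)) = 1" if "u \<in> insert v S" for u
      using hom_onD(4)[OF f(2)[OF t] that] hom_onD(4)[OF Fs[OF t] that]
      by (cases "u = v") (simp_all add: f1_def)
    show "f1 t (u, j) \<ge> 0" for u j
      using hom_onD(3)[OF f(2)[OF t]] hom_onD(3)[OF Fs[OF t]] by (simp add: f1_def)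
    show False if "{u, w} \<in> E" "f1 t (u, j) \<noteq> 0" "f1 t (w, j) \<noteq> 0" for u w j
      using f1supp[OF t] that hom_onD(5)[OF f(2)[OF t], of u w j] by auto
  qed
  have h1: "homotopic_with (\<lambda>_. True) (top_of_set (sph i)) (top_of_set ?X) f f1"
  proof (rule homotopic_straight_line[OF f(1) f1c])
    fix t u assume t: "t \<in> sph i" and u: "0 \<le> u" "u \<le> (1::real)"
    show "(\<lambda>p. (1 - u) * f t p + u * f1 t p) \<in> ?X"
    proof (rule hom_on_mix[OF f(2)[OF t] f1X[OF t] u])
      show False if "{a, b} \<in> E" "f t (a, j) \<noteq> 0" "f1 t (b, j) \<noteq> 0" for a b j
        using that hom_onD(5)[OF f(2)[OF t]] f1supp[OF t] by blast
    qed
  qed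
  have h2: "homotopic_with (\<lambda>_. True) (top_of_set (sph i)) (top_of_set ?X) f1 F"
  proof (rule homotopic_straight_line[OF f1c Fc])
    fix t u assume t: "t \<in> sph i" and u: "0 \<le> u" "u \<le> (1::real)"
    show "(\<lambda>p. (1 - u) * f1 t p + u * F t p) \<in> ?X"
    proof (rule hom_on_mix[OF f1X[OF t] Fs[OF t] u])
      show False if e: "{a, b} \<in> E" "f1 t (a, j) \<noteq> 0" "F t (b, j) \<noteq> 0" for a b j
      proof (cases "b = v")
        case True
        then have "a \<noteq> v" using e(1) v(2) by auto
        then have "F t (a, j) \<noteq> 0" using e(2) by (simp add: f1_def)
        then show False using hom_onD(5)[OF Fs[OF t] e(1) _ e(3)] by simp
      next
        case False
        then have "f1 t (b, j) \<noteq> 0" using e(3) by (simp add: f1_def)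
        then show False using hom_onD(5)[OF f1X[OF t] e(1,2)] by simp
      qed
    qed
  qed
  \<comment> \<open>\<open>F\<close> is defined on the whole disc, so shrinking the sphere to the
    origin contracts its image.\<close>
  have h3: "homotopic_with (\<lambda>_. True) (top_of_set (sph i)) (top_of_set ?X) F (\<lambda>_. F (\<lambda>_. 0))"
  proof -
    define g where "g = (\<lambda>(u::real, y::nat \<Rightarrow> real). F (\<lambda>k. (1 - u) * y k))"
    have scale: "(\<lambda>k. (1 - u) * y k) \<in> disc i" if "0 \<le> u" "u \<le> 1" "y \<in> sph i" for u y
    proof -
      have "(\<Sum>k\<le>i. ((1 - u) * y k)\<^sup>2) = (1 - u)\<^sup>2"
        using that(3) by (simp add: power_mult_distrib sph_def flip: sum_distrib_left)
      then show ?thesis using that by (auto simp: disc_def sph_def abs_square_le_1)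
    qed
    have "continuous_on ({0..1} \<times> sph i) g"
      unfolding g_def case_prod_beta
    proof (rule continuous_on_compose2[OF F(1)])
      show "continuous_on ({0..1} \<times> sph i) (\<lambda>p k. (1 - fst p) * snd p k)"
        by (intro continuous_on_coordinatewise_then_product continuous_intros
            continuous_on_product_then_coordinatewise[OF continuous_on_snd[OF continuous_on_id]])
    qed (auto intro: scale)
    moreover have "g ` ({0..1} \<times> sph i) \<subseteq> ?X" using scale FX by (auto simp: g_def)
    ultimately show ?thesis
      unfolding homotopic_with_def by (intro exI[of _ g]) (auto simp: g_def image_subset_iff_funcset)
  qed
  show "\<exists>c. homotopic_with (\<lambda>_. True) (top_of_set (sph i)) (top_of_set ?X) f (\<lambda>_. c)"
    using homotopic_with_trans[OF homotopic_with_trans[OF h1 h2] h3] by blast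
qed

section \<open>Connectivity of the complex from bounded degeneracy\<close>

lemma hom_on_empty: "hom_on {} E m = {\<lambda>_. 0}"
proof -
  have "x = (\<lambda>_. 0)" if "x \<in> hom_on {} E m" for x
    using hom_onD(1)[OF that] by fastforce
  moreover have "(\<lambda>_. 0) \<in> hom_on {} E m" by (rule hom_onI) auto
  ultimately show ?thesis by blast
qed

text \<open>\<open>Dmax\<close> dominates the minimum degree of every induced subgraph; this minimum
  is attained at some vertex of \<open>S\<close>.\<close>

lemma degenerate_vertex:
  assumes "S \<subseteq> {0..<n}" "S \<noteq> {}"
  shows "\<exists>v\<in>S. deg_in E S v \<le> Dmax n E"
proof -
  have fin: "finite S" using assms(1) finite_subset by blast
  have "{Min (deg_in E S ` S) | S. S \<subseteq> {0..<n} \<and> S \<noteq> {}}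
      = (\<lambda>S. Min (deg_in E S ` S)) ` {S. S \<subseteq> {0..<n} \<and> S \<noteq> {}}" by auto
  then have "finite {Min (deg_in E S ` S) | S. S \<subseteq> {0..<n} \<and> S \<noteq> {}}" by simp
  then have "Min (deg_in E S ` S) \<le> Dmax n E"
    unfolding Dmax_def using assms by (intro Max_ge) auto
  moreover have "Min (deg_in E S ` S) \<in> deg_in E S ` S" using fin assms(2) by (intro Min_in) auto
  ultimately show ?thesis by auto
qed

text \<open>Induction on \<open>S\<close>, removing a vertex with at most \<open>k\<close>
  neighbours in \<open>S\<close>; without vertices the complex is a point. Nonemptiness is the
  extension over a one-point space, of box dimension 0, hence the condition \<open>k < m\<close>.
  For \<open>i\<close>-spheres the disc has dimension \<open>i + 1\<close>, hence
  \<open>i + 1 + k < m\<close>.\<close>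

lemma hom_on_connected:
  assumes E: "E \<subseteq> all_pairs n" and D: "Dmax n E \<le> k" and S: "S \<subseteq> {0..<n}"
  shows "(k < m \<longrightarrow> hom_on S E m \<noteq> {}) \<and> (\<forall>i. i + 1 + k < m \<longrightarrow> pi_trivial (hom_on S E m) i)"
proof -
  have "finite S" using S finite_subset by blast
  then show ?thesis using S
  proof (induction S rule: finite_psubset_induct)
    case (psubset S)
    show ?case
    proof (cases "S = {}")
      case True
      have "pi_trivial {\<lambda>_ :: nat \<times> nat. 0 :: real} i" for i
        unfolding pi_trivial_def
      proof (intro allI impI)
        fix f :: "(nat \<Rightarrow> real) \<Rightarrow> nat \<times> nat \<Rightarrow> real"
        assume f: "continuous_map (top_of_set (sph i)) (top_of_set {\<lambda>_. 0}) f"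
        then have "homotopic_with (\<lambda>_. True) (top_of_set (sph i)) (top_of_set {\<lambda>_. 0}) f (\<lambda>_. \<lambda>_. 0)"
          by (intro homotopic_with_equal) (auto simp: image_subset_iff Pi_iff)
        then show "\<exists>c. homotopic_with (\<lambda>_. True) (top_of_set (sph i)) (top_of_set {\<lambda>_. 0}) f (\<lambda>_. c)"
          by blast
      qed
      then show ?thesis by (simp add: True hom_on_empty)
    next
      case False
      obtain v where v: "v \<in> S" "deg_in E S v \<le> k"
        using degenerate_vertex[OF psubset.prems False, of E] D by force
      define W where "W = {u \<in> S - {v}. {u, v} \<in> E}"
      \<comment> \<open>\<open>{v}\<close> would be the loop \<open>{v, v}\<close>. Its absence
        makes the neighbours of \<open>v\<close> in \<open>S\<close> and in \<open>S - {v}\<close>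
        the same.\<close>
      have vE: "{v} \<notin> E" using E by (auto simp: all_pairs_def)
      have "W = {u \<in> S. {u, v} \<in> E}" using vE by (auto simp: W_def)
      then have cW: "card W \<le> k" using v(2) by (simp add: deg_in_def)
      have finW: "finite W" using psubset.hyps by (simp add: W_def)
      have ins: "insert v (S - {v}) = S" using v(1) by auto
      have IH: "(k < m \<longrightarrow> hom_on (S - {v}) E m \<noteq> {}) \<and>
          (\<forall>i. i + 1 + k < m \<longrightarrow> pi_trivial (hom_on (S - {v}) E m) i)"
        using v(1) psubset.prems by (intro psubset.IH) auto
      show ?thesis
      proof (intro conjI allI impI)
        assume k: "k < m"
        then obtain x where x: "x \<in> hom_on (S - {v}) E m" using IH by blast
        have "0 + card W < m" using cW k by simp
        moreover have "(\<lambda>_::real. x) ` {0} \<subseteq> hom_on (S - {v}) E m" using x by simp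
        moreover have "v \<notin> S - {v}" "compact {0::real}" "continuous_on {0::real} (\<lambda>_. x)" by auto
        ultimately obtain F where "F ` {0::real} \<subseteq> hom_on (insert v (S - {v})) E m"
          using extend_vertex[OF _ box_dim_le_singleton W_def finW _ _ vE] by metis
        then show "hom_on S E m \<noteq> {}" using v(1) by (auto simp: insert_absorb)
      next
        fix i assume "i + 1 + k < m"
        then show "pi_trivial (hom_on S E m) i"
          using pi_trivial_insert_vertex[OF W_def finW _ _ vE, of i m] cW IH v(1)
          by (auto simp: insert_absorb)
      qed
    qed
  qed
qed

text \<open>\<open>i + 1 + k < m\<close> means \<open>i <= m - k - 2\<close>, and
  \<open>k < m\<close> means that \<open>m - k - 2\<close> is at least -1. For smaller values being
  \<open>j\<close>-connected is vacuous.\<close>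

lemma Mconn_ge:
  assumes "E \<subseteq> all_pairs n" "Dmax n E \<le> k"
  shows "ereal (real_of_int (int m - int k - 2)) \<le> Mconn n E m"
proof -
  have "j_connected (hom_real n E m) (int m - int k - 2)"
    using hom_on_connected[OF assms order_refl, of m]
    unfolding j_connected_def hom_real_eq_hom_on by auto
  then show ?thesis unfolding Mconn_def conn_def by (intro Sup_upper) blast
qed

section \<open>Isolated edges bound the connectivity\<close>

text \<open>Makes the homological fact that \<open>nsphere\<close> is not contractible available for
  \<open>sph\<close>.\<close>

lemma top_of_set_sph: "top_of_set (sph d) = nsphere d"
proof -
  have "sph d = {x. (\<Sum>i\<le>d. (x i)\<^sup>2) = 1 \<and> (\<forall>i>d. x i = 0)}"
    by (auto simp: sph_def)
  then show ?thesis by (simp add: nsphere euclidean_product_topology)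
qed

text \<open>A null-homotopy of \<open>g\<close>, followed by \<open>r\<close>, would be one of the
  identity of the sphere.\<close>

lemma sph_retract_not_pi_trivial:
  fixes X :: "'a::topological_space set"
  assumes g: "continuous_on (sph d) g" "g ` sph d \<subseteq> X"
    and r: "continuous_on X r" "r ` X \<subseteq> sph d" "\<And>y. y \<in> sph d \<Longrightarrow> r (g y) = y"
  shows "\<not> pi_trivial X d"
proof
  assume "pi_trivial X d"
  then obtain c where "homotopic_with (\<lambda>_. True) (top_of_set (sph d)) (top_of_set X) g (\<lambda>_. c)"
    using g unfolding pi_trivial_def by (auto simp: image_subset_iff_funcset)
  moreover have "continuous_map (top_of_set X) (top_of_set (sph d)) r"
    using r by (auto simp: image_subset_iff_funcset)
  ultimately have "homotopic_with (\<lambda>_. True) (top_of_set (sph d)) (top_of_set (sph d)) (r \<circ> g) (r \<circ> (\<lambda>_. c))"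
    by (intro homotopic_with_compose_continuous_map_left) auto
  then have "homotopic_with (\<lambda>_. True) (top_of_set (sph d)) (top_of_set (sph d)) id (\<lambda>_. r c)"
    by (rule homotopic_with_eq) (auto simp: r(3))
  then have "contractible_space (nsphere d)"
    unfolding contractible_space_def top_of_set_sph by blast
  then show False using non_contractible_space_nsphere by blast
qed

text \<open>Vectors of coordinate sum 0 in \<open>m\<close> coordinates form a space of dimension
  \<open>m - 1\<close>, whose unit sphere has dimension \<open>m - 2\<close>. Such a vector is
  realised as a difference of colour weights by giving its positive part to \<open>a\<close> and its
  negative part to \<open>b\<close>. As the edge is isolated, all other vertices can keep the
  colours of \<open>x0\<close>.\<close>

lemma isolated_edge_not_pi_trivial:
  assumes m: "m \<ge> 2" and ab: "a < n" "b < n" "a \<noteq> b" "{a, b} \<in> E"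
    and iso: "\<And>e. e \<in> E \<Longrightarrow> e \<inter> {a, b} \<noteq> {} \<Longrightarrow> e = {a, b}"
    and x0: "x0 \<in> hom_real n E m"
  shows "\<not> pi_trivial (hom_real n E m) (m - 2)"
proof -
  define d where "d = m - 2"
  have md: "{..<m} = insert (Suc d) {..d}" using m by (auto simp: d_def)
  have dm: "i < m" if "i \<le> d" for i using that m by (simp add: d_def)
  have md': "i \<le> d \<or> i = Suc d" if "i < m" for i using that by (auto simp: d_def)
  \<comment> \<open>\<open>z\<close> identifies \<open>\<real>^(d + 1)\<close> with the vectors in \<open>\<real>^m\<close> of coordinate sum 0.\<close>
  define z where "z y i = (if i \<le> d then y i else - (\<Sum>k\<le>d. y k))" for y :: "nat \<Rightarrow> real" and i
  define P where "P y = (\<Sum>i<m. max 0 (z y i))" for y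
  have sumz: "(\<Sum>i<m. z y i) = 0" for y
    by (simp add: md z_def)
  \<comment> \<open>Positive and negative parts have equal totals because the coordinates sum to 0.
    Hence the same \<open>P y\<close> normalises both, and the difference of the two distributions
    is a positive multiple of \<open>z y\<close>.\<close>
  have PN: "(\<Sum>i<m. max 0 (- z y i)) = P y" for y
  proof -
    have "(\<Sum>i<m. max 0 (z y i) - max 0 (- z y i)) = (\<Sum>i<m. z y i)"
      by (intro sum.cong) auto
    then show ?thesis using sumz by (simp add: sum_subtractf P_def)
  qed
  have Ppos: "P y > 0" if y: "y \<in> sph d" for y
  proof (rule ccontr)
    assume "\<not> P y > 0"
    moreover have "P y \<ge> 0" by (simp add: P_def sum_nonneg)
    ultimately have "P y = 0" by simp
    then have "\<forall>i<m. max 0 (z y i) = 0" "\<forall>i<m. max 0 (- z y i) = 0"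
      using PN[of y] by (auto simp: P_def sum_nonneg_eq_0_iff)
    then have "\<forall>i<m. z y i \<le> 0 \<and> - z y i \<le> 0" by (metis max.cobounded2)
    then have "\<forall>i<m. z y i = 0" by force
    then have "y i = 0" if "i \<le> d" for i using dm[OF that] that by (auto simp: z_def)
    then show False using y by (simp add: sph_def)
  qed
  define g where "g y p = (case p of (v, i) \<Rightarrow>
      if i < m \<and> v = a then max 0 (z y i) / P y
      else if i < m \<and> v = b then max 0 (- z y i) / P y else x0 (v, i))" for y p
  have x0': "x0 \<in> hom_on {0..<n} E m" using x0 by (simp add: hom_real_eq_hom_on)
  have gX: "g y \<in> hom_on {0..<n} E m" if y: "y \<in> sph d" for y
  proof (rule hom_onI)
    show "v \<in> {0..<n} \<and> i < m" if "g y (v, i) \<noteq> 0" for v i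
      using that hom_onD(1,2)[OF x0', of v i] ab by (auto simp: g_def split: if_splits)
    show "g y (v, i) \<ge> 0" for v i
      using hom_onD(3)[OF x0', of v i] Ppos[OF y] by (simp add: g_def)
    show "(\<Sum>i<m. g y (v, i)) = 1" if "v \<in> {0..<n}" for v
    proof -
      have "(\<Sum>i<m. g y (v, i)) = P y / P y" if "v = a \<or> v = b"
        using that ab(3) PN[of y] by (auto simp: g_def P_def simp flip: sum_divide_distrib)
      moreover have "(\<Sum>i<m. g y (v, i)) = 1" if "\<not> (v = a \<or> v = b)"
        using that hom_onD(4)[OF x0' \<open>v \<in> {0..<n}\<close>] by (simp add: g_def)
      ultimately show ?thesis using Ppos[OF y] by auto
    qed
    show False if e: "{u, w} \<in> E" and nz: "g y (u, i) \<noteq> 0" "g y (w, i) \<noteq> 0" for u w i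
    proof (cases "{u, w} \<inter> {a, b} = {}")
      case True
      then have "x0 (u, i) \<noteq> 0" "x0 (w, i) \<noteq> 0" using nz by (auto simp: g_def split: if_splits)
      then show False using hom_onD(5)[OF x0' e] by blast
    next
      case False
      then have "{u, w} = {a, b}" using iso[OF e] by blast
      then have "g y (a, i) \<noteq> 0" "g y (b, i) \<noteq> 0" using nz by (auto simp: doubleton_eq_iff)
      moreover from this have "i < m"
        using hom_onD(2)[OF x0'] by (auto simp: g_def split: if_splits)
      ultimately show False using ab(3) by (auto simp: g_def max_def split: if_splits)
    qed
  qed
  have gc: "continuous_on (sph d) g"
  proof (rule continuous_on_coordinatewise_then_product)
    fix p :: "nat \<times> nat"
    obtain v i where p: "p = (v, i)" by fastforce
    have zc: "continuous_on (sph d) (\<lambda>y. z y i)" for i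
      by (cases "i \<le> d") (auto simp: z_def intro!: continuous_on_minus continuous_on_sum
            continuous_on_product_then_coordinatewise[OF continuous_on_id])
    have Pc: "continuous_on (sph d) P" unfolding P_def by (intro continuous_intros zc)
    have "\<forall>y\<in>sph d. P y \<noteq> 0" using Ppos by fastforce
    then show "continuous_on (sph d) (\<lambda>y. g y p)"
      unfolding g_def p prod.case
      by (cases "i < m"; cases "v = a"; cases "v = b") (simp_all, (intro continuous_intros zc Pc; simp)+)
  qed
  \<comment> \<open>The last coordinate of the difference is dropped, since the zero sum determines
    it; this inverts \<open>z\<close> up to a positive factor.\<close>
  define q where "q x k = (if k \<le> d then x (a, k) - x (b, k) else 0)" for x :: "nat \<times> nat \<Rightarrow> real" and k
  define r where "r x k = q x k / sqrt (\<Sum>k\<le>d. (q x k)\<^sup>2)" for x k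
  \<comment> \<open>If the first \<open>d + 1\<close> weights agree, total weight 1 makes the last
    ones agree too. But the two ends of an edge have disjoint supports, so equal distributions would
    vanish.\<close>
  have qnz: "(\<Sum>k\<le>d. (q x k)\<^sup>2) \<noteq> 0" if x: "x \<in> hom_on {0..<n} E m" for x
  proof
    assume "(\<Sum>k\<le>d. (q x k)\<^sup>2) = 0"
    then have "\<forall>k\<le>d. q x k = 0" by (auto simp: sum_nonneg_eq_0_iff)
    then have eq: "x (a, k) = x (b, k)" if "k \<le> d" for k using that by (auto simp: q_def)
    then have s: "(\<Sum>k\<le>d. x (a, k)) = (\<Sum>k\<le>d. x (b, k))" by (intro sum.cong) auto
    have "(\<Sum>k<m. x (a, k)) = 1" "(\<Sum>k<m. x (b, k)) = 1" using hom_onD(4)[OF x] ab by auto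
    then have "x (a, Suc d) = x (b, Suc d)" using s unfolding md by simp
    with eq have "x (a, k) = x (b, k)" if "k < m" for k
      using md'[OF that] by auto
    then have "x (a, k) = 0" if "k < m" for k
      using hom_onD(5)[OF x ab(4), of k] that by force
    then show False using \<open>(\<Sum>k<m. x (a, k)) = 1\<close> by simp
  qed
  have "\<not> pi_trivial (hom_on {0..<n} E m) d"
  proof (rule sph_retract_not_pi_trivial[OF gc])
    show "g ` sph d \<subseteq> hom_on {0..<n} E m" using gX by auto
    show "r ` hom_on {0..<n} E m \<subseteq> sph d"
      unfolding r_def using qnz by (intro image_subsetI sph_normalise) (auto simp: q_def)
    have qc: "continuous_on T (\<lambda>x. q x k)" for T k
      by (cases "k \<le> d") (auto simp: q_def intro!: continuous_on_diff continuous_on_const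
          continuous_on_product_then_coordinatewise[OF continuous_on_id])
    show "continuous_on (hom_on {0..<n} E m) r"
      unfolding r_def using qnz
      by (intro continuous_on_coordinatewise_then_product continuous_intros qc) auto
    show "r (g y) = y" if y: "y \<in> sph d" for y
    proof
      fix k
      have q: "q (g y) k = y k / P y" if "k \<le> d" for k
      proof -
        have k: "k < m" using that by (rule dm)
        have "g y (a, k) - g y (b, k) = (max 0 (y k) - max 0 (- y k)) / P y"
          using k that ab(3) by (simp add: g_def z_def diff_divide_distrib)
        moreover have "max 0 (y k) - max 0 (- y k) = y k" by auto
        ultimately show ?thesis using that by (simp add: q_def)
      qed
      have "(\<Sum>k\<le>d. (q (g y) k)\<^sup>2) = (\<Sum>k\<le>d. (y k)\<^sup>2) / (P y)\<^sup>2"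
        using q by (simp add: power_divide sum_divide_distrib)
      also have "\<dots> = (1 / P y)\<^sup>2" using y by (simp add: sph_def power_divide)
      finally have "sqrt (\<Sum>k\<le>d. (q (g y) k)\<^sup>2) = 1 / P y" using Ppos[OF y] by simp
      then show "r (g y) k = y k"
        using Ppos[OF y] q[of k] y by (cases "k \<le> d") (auto simp: r_def q_def sph_def)
    qed
  qed
  then show ?thesis by (simp add: hom_real_eq_hom_on d_def)
qed

text \<open>Being \<open>j\<close>-connected with \<open>j >= m - 2\<close> includes nonemptiness,
  which supplies the point \<open>x0\<close>, and triviality in dimension \<open>m - 2\<close>,
  which the isolated edge contradicts. An empty complex thus needs no separate case.\<close>

lemma Mconn_le:
  assumes m: "m \<ge> 2" and ab: "a < n" "b < n" "a \<noteq> b" "{a, b} \<in> E"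
    and iso: "\<And>e. e \<in> E \<Longrightarrow> e \<inter> {a, b} \<noteq> {} \<Longrightarrow> e = {a, b}"
  shows "Mconn n E m \<le> ereal (real_of_int (int m - 3))"
  unfolding Mconn_def conn_def
proof (rule Sup_least, clarsimp)
  fix j assume j: "j_connected (hom_real n E m) j"
  have "j \<le> int m - 3"
  proof (rule ccontr)
    assume "\<not> j \<le> int m - 3"
    then have jm: "int (m - 2) \<le> j" "-1 \<le> j" using m by auto
    then obtain x0 where "x0 \<in> hom_real n E m" using j by (auto simp: j_connected_def)
    from isolated_edge_not_pi_trivial[OF m ab iso this] show False
      using j jm(1) by (auto simp: j_connected_def)
  qed
  then show "real_of_int j \<le> real m - 3" by linarith
qed

section \<open>Random graphs\<close>

definition subset_expectation :: "'a set \<Rightarrow> real \<Rightarrow> ('a set \<Rightarrow> real) \<Rightarrow> real" where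
  "subset_expectation A p f = (\<Sum>E\<in>Pow A. p ^ card E * (1 - p) ^ (card A - card E) * f E)"

text \<open>Conditioning on whether \<open>a\<close> is chosen; this drives the inductions
  below.\<close>

lemma subset_expectation_insert:
  assumes "finite A" "a \<notin> A"
  shows "subset_expectation (insert a A) p f
    = (1 - p) * subset_expectation A p f + p * subset_expectation A p (\<lambda>E. f (insert a E))"
proof -
  let ?w = "\<lambda>E. p ^ card E * (1 - p) ^ (card (insert a A) - card E) * f E"
  have disj: "Pow A \<inter> insert a ` Pow A = {}" using assms(2) by auto
  have inj: "inj_on (insert a) (Pow A)" using assms(2) by (intro inj_onI) (metis Diff_insert_absorb PowD subsetD)
  have "subset_expectation (insert a A) p f = sum ?w (Pow A) + sum ?w (insert a ` Pow A)"
    unfolding subset_expectation_def Pow_insert using assms(1) disj by (intro sum.union_disjoint) auto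
  also have "sum ?w (Pow A) = (1 - p) * subset_expectation A p f"
    unfolding subset_expectation_def sum_distrib_left
  proof (rule sum.cong)
    fix E assume "E \<in> Pow A"
    then have "card E \<le> card A" using assms(1) by (auto intro: card_mono)
    then show "?w E = (1 - p) * (p ^ card E * (1 - p) ^ (card A - card E) * f E)"
      using assms by (simp add: Suc_diff_le)
  qed simp
  also have "sum ?w (insert a ` Pow A) = p * subset_expectation A p (\<lambda>E. f (insert a E))"
    unfolding subset_expectation_def sum_distrib_left sum.reindex[OF inj]
  proof (rule sum.cong)
    fix E assume E: "E \<in> Pow A"
    then have "card (insert a E) = Suc (card E)" using assms by (auto intro!: card_insert_disjoint intro: finite_subset)
    then show "(?w \<circ> insert a) E = p * (p ^ card E * (1 - p) ^ (card A - card E) * f (insert a E))"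
      using assms by simp
  qed simp
  finally show ?thesis .
qed

lemma subset_expectation_cong:
  "(\<And>E. E \<subseteq> A \<Longrightarrow> f E = g E) \<Longrightarrow> subset_expectation A p f = subset_expectation A p g"
  unfolding subset_expectation_def by (intro sum.cong) auto

lemma subset_expectation_mono:
  assumes "0 \<le> p" "p \<le> 1" "\<And>E. E \<subseteq> A \<Longrightarrow> f E \<le> g E"
  shows "subset_expectation A p f \<le> subset_expectation A p g"
  unfolding subset_expectation_def using assms by (intro sum_mono mult_left_mono) auto

lemma subset_expectation_add:
  "subset_expectation A p (\<lambda>E. f E + g E) = subset_expectation A p f + subset_expectation A p g"
  unfolding subset_expectation_def by (simp add: distrib_left sum.distrib)

lemma subset_expectation_cmult:
  "subset_expectation A p (\<lambda>E. c * f E) = c * subset_expectation A p f"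
  unfolding subset_expectation_def sum_distrib_left by (intro sum.cong) auto

lemma subset_expectation_sum:
  "subset_expectation A p (\<lambda>E. \<Sum>i\<in>I. f i E) = (\<Sum>i\<in>I. subset_expectation A p (f i))"
  unfolding subset_expectation_def by (simp add: sum_distrib_left sum.swap[of _ _ I])

lemma subset_expectation_const:
  assumes "finite A"
  shows "subset_expectation A p (\<lambda>_. c) = c"
  using assms
proof (induction A)
  case empty
  then show ?case by (simp add: subset_expectation_def)
next
  case (insert a A)
  then show ?case by (simp add: subset_expectation_insert algebra_simps)
qed

text \<open>Induction takes the place of a coupling: both conditional expectations grow with
  \<open>p\<close>, and the one with \<open>a\<close> chosen is the larger, so moving weight to it
  also increases the total.\<close>

lemma subset_expectation_mono_prob:
  assumes "finite A" "0 \<le> p" "p \<le> p'" "p' \<le> 1"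
    and "\<And>E E'. E \<subseteq> E' \<Longrightarrow> E' \<subseteq> A \<Longrightarrow> f E \<le> f E'"
  shows "subset_expectation A p f \<le> subset_expectation A p' f"
  using assms(1,5)
proof (induction A arbitrary: f)
  case empty
  then show ?case by (simp add: subset_expectation_def)
next
  case (insert a A)
  let ?u = "\<lambda>p. subset_expectation A p f" and ?v = "\<lambda>p. subset_expectation A p (\<lambda>E. f (insert a E))"
  have u: "?u p \<le> ?u p'" by (rule insert.IH) (rule insert.prems, auto)
  have v: "?v p \<le> ?v p'" by (rule insert.IH) (rule insert.prems, auto)
  have uv: "?u p' \<le> ?v p'"
    by (intro subset_expectation_mono insert.prems) (use assms in auto)
  have "(1 - p) * ?u p + p * ?v p \<le> (1 - p) * ?u p' + p * ?v p'"
    using u v assms by (intro add_mono mult_left_mono) auto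
  also have "\<dots> = ?u p' + p * (?v p' - ?u p')" by (simp add: algebra_simps)
  also have "\<dots> \<le> ?u p' + p' * (?v p' - ?u p')"
    using uv assms by (intro add_left_mono mult_right_mono) auto
  also have "\<dots> = (1 - p') * ?u p' + p' * ?v p'" by (simp add: algebra_simps)
  finally show ?case using insert.hyps by (simp add: subset_expectation_insert)
qed

text \<open>Independence: prescribed elements contribute a factor each, and all others average out
  to 1.\<close>

lemma subset_expectation_cylinder:
  assumes "finite A" "X \<subseteq> A" "Y \<subseteq> A" "X \<inter> Y = {}"
  shows "subset_expectation A p (\<lambda>E. of_bool (X \<subseteq> E \<and> E \<inter> Y = {})) = p ^ card X * (1 - p) ^ card Y"
  using assms
proof (induction A arbitrary: X Y)
  case empty
  then show ?case by (simp add: subset_expectation_def)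
next
  case (insert a A)
  note ins = subset_expectation_insert[OF insert.hyps]
  have fin: "finite X" "finite Y" using insert.prems insert.hyps by (auto intro: finite_subset)
  consider "a \<in> X" "a \<notin> Y" | "a \<in> Y" "a \<notin> X" | "a \<notin> X" "a \<notin> Y" using insert.prems by blast
  then show ?case
  proof cases
    case 1
    have "subset_expectation A p (\<lambda>E. of_bool (X \<subseteq> E \<and> E \<inter> Y = {})) = subset_expectation A p (\<lambda>_. 0)"
      using 1 insert.hyps by (intro subset_expectation_cong) auto
    moreover have "subset_expectation A p (\<lambda>E. of_bool (X \<subseteq> insert a E \<and> insert a E \<inter> Y = {}))
        = subset_expectation A p (\<lambda>E. of_bool (X - {a} \<subseteq> E \<and> E \<inter> Y = {}))"
      using 1 by (intro subset_expectation_cong) (auto simp: subset_insert_iff)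
    moreover have "subset_expectation A p (\<lambda>E. of_bool (X - {a} \<subseteq> E \<and> E \<inter> Y = {}))
        = p ^ card (X - {a}) * (1 - p) ^ card Y"
      using 1 insert.prems by (intro insert.IH) auto
    ultimately show ?thesis
      using card.remove[OF fin(1) 1(1)] insert.hyps by (simp add: ins subset_expectation_const)
  next
    case 2
    have "subset_expectation A p (\<lambda>E. of_bool (X \<subseteq> insert a E \<and> insert a E \<inter> Y = {})) = subset_expectation A p (\<lambda>_. 0)"
      using 2 by (intro subset_expectation_cong) auto
    moreover have "subset_expectation A p (\<lambda>E. of_bool (X \<subseteq> E \<and> E \<inter> Y = {}))
        = subset_expectation A p (\<lambda>E. of_bool (X \<subseteq> E \<and> E \<inter> (Y - {a}) = {}))"
      using 2 insert.hyps by (intro subset_expectation_cong arg_cong[where f = of_bool]) auto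
    moreover have "subset_expectation A p (\<lambda>E. of_bool (X \<subseteq> E \<and> E \<inter> (Y - {a}) = {}))
        = p ^ card X * (1 - p) ^ card (Y - {a})"
      using 2 insert.prems by (intro insert.IH) auto
    ultimately show ?thesis
      using card.remove[OF fin(2) 2(1)] insert.hyps by (simp add: ins subset_expectation_const)
  next
    case 3
    have "subset_expectation A p (\<lambda>E. of_bool (X \<subseteq> insert a E \<and> insert a E \<inter> Y = {}))
        = subset_expectation A p (\<lambda>E. of_bool (X \<subseteq> E \<and> E \<inter> Y = {}))"
      using 3 by (intro subset_expectation_cong arg_cong[where f = of_bool]) auto
    moreover have "subset_expectation A p (\<lambda>E. of_bool (X \<subseteq> E \<and> E \<inter> Y = {})) = p ^ card X * (1 - p) ^ card Y"
      using 3 insert.prems by (intro insert.IH) auto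
    ultimately show ?thesis by (simp add: ins algebra_simps)
  qed
qed

text \<open>Chebyshev without division: where \<open>X E = 0\<close>, the square
  \<open>(X E - \<mu>)\<close> times itself equals \<open>\<mu>\<close> squared, and elsewhere it is
  nonnegative.\<close>

lemma second_moment:
  fixes X :: "'a set \<Rightarrow> real"
  assumes A: "finite A" and p: "0 \<le> p" "p \<le> 1"
  defines "\<mu> \<equiv> subset_expectation A p X"
  shows "\<mu>\<^sup>2 * subset_expectation A p (\<lambda>E. of_bool (X E = 0)) \<le> subset_expectation A p (\<lambda>E. (X E)\<^sup>2) - \<mu>\<^sup>2"
proof -
  have "\<mu>\<^sup>2 * subset_expectation A p (\<lambda>E. of_bool (X E = 0)) = subset_expectation A p (\<lambda>E. \<mu>\<^sup>2 * of_bool (X E = 0))"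
    by (simp add: subset_expectation_cmult)
  also have "\<dots> \<le> subset_expectation A p (\<lambda>E. (X E)\<^sup>2 + ((- 2 * \<mu>) * X E + \<mu>\<^sup>2))"
  proof (rule subset_expectation_mono[OF p])
    fix E
    have "(X E)\<^sup>2 + ((- 2 * \<mu>) * X E + \<mu>\<^sup>2) = (X E - \<mu>)\<^sup>2" by (simp add: power2_diff)
    then show "\<mu>\<^sup>2 * of_bool (X E = 0) \<le> (X E)\<^sup>2 + ((- 2 * \<mu>) * X E + \<mu>\<^sup>2)"
      by (cases "X E = 0") simp_all
  qed
  also have "\<dots> = subset_expectation A p (\<lambda>E. (X E)\<^sup>2) - \<mu>\<^sup>2"
    using A by (simp only: subset_expectation_add subset_expectation_cmult subset_expectation_const)
      (simp add: \<mu>_def power2_eq_square)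
  finally show ?thesis .
qed

lemma finite_all_pairs: "finite (all_pairs n)"
  by (rule finite_subset[of _ "Pow {..<n}"]) (auto simp: all_pairs_def)

lemma all_pairs_eq: "all_pairs n = {e. e \<subseteq> {..<n} \<and> card e = 2}"
  by (auto simp: all_pairs_def card_2_iff)

lemma gnp_prob_eq: "gnp_prob n p P = subset_expectation (all_pairs n) p (\<lambda>E. of_bool (P E))"
proof -
  have eq: "{E. E \<subseteq> all_pairs n \<and> P E} = {E \<in> Pow (all_pairs n). P E}" by auto
  have fin: "finite (Pow (all_pairs n))" by (simp add: finite_all_pairs)
  show ?thesis
    unfolding gnp_prob_def subset_expectation_def eq sum.inter_filter[OF fin]
    by (intro sum.cong) auto
qed

lemma gnp_prob_nonneg: "0 \<le> p \<Longrightarrow> p \<le> 1 \<Longrightarrow> 0 \<le> gnp_prob n p P"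
  unfolding gnp_prob_def by (intro sum_nonneg) auto

lemma gnp_prob_le_1: "0 \<le> p \<Longrightarrow> p \<le> 1 \<Longrightarrow> gnp_prob n p P \<le> 1"
  using subset_expectation_mono[of p "all_pairs n" "\<lambda>E. of_bool (P E)" "\<lambda>_. 1"]
  by (simp add: gnp_prob_eq subset_expectation_const finite_all_pairs)

lemma gnp_prob_union_bound:
  assumes "0 \<le> p" "p \<le> 1" "\<And>E. E \<subseteq> all_pairs n \<Longrightarrow> P E \<or> Q E \<or> R E"
  shows "1 \<le> gnp_prob n p P + gnp_prob n p Q + gnp_prob n p R"
proof -
  have "subset_expectation (all_pairs n) p (\<lambda>_. 1) \<le> subset_expectation (all_pairs n) p
      (\<lambda>E. (of_bool (P E) + of_bool (Q E)) + of_bool (R E))"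
  proof (rule subset_expectation_mono[OF assms(1,2)])
    show "1 \<le> of_bool (P E) + of_bool (Q E) + (of_bool (R E) :: real)" if "E \<subseteq> all_pairs n" for E
      using assms(3)[OF that] by auto
  qed
  then show ?thesis
    by (simp add: gnp_prob_eq subset_expectation_add subset_expectation_const finite_all_pairs)
qed

section \<open>Existence of an isolated edge by the second moment method\<close>

definition isolated_edge :: "nat set set \<Rightarrow> nat set \<Rightarrow> bool" where
  "isolated_edge E e \<longleftrightarrow> e \<in> E \<and> (\<forall>e'\<in>E. e' \<inter> e \<noteq> {} \<longrightarrow> e' = e)"

definition touching :: "nat \<Rightarrow> nat set \<Rightarrow> nat set set" where
  "touching n e = {e' \<in> all_pairs n. e' \<noteq> e \<and> e' \<inter> e \<noteq> {}}"

text \<open>Exhibits isolation as a cylinder event, whose probability is a product.\<close>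

lemma isolated_edge_iff:
  assumes "E \<subseteq> all_pairs n"
  shows "isolated_edge E e \<longleftrightarrow> {e} \<subseteq> E \<and> E \<inter> touching n e = {}"
  using assms unfolding isolated_edge_def touching_def by blast

lemma finite_touching: "finite (touching n e)"
  unfolding touching_def using finite_all_pairs by simp

text \<open>Each of the two endpoints lies in at most \<open>n\<close> such pairs. This crude count
  still leaves \<open>(1 - p) ^ (2 * n)\<close> with a positive limit for
  \<open>p = c / n\<close>.\<close>

lemma card_touching_le:
  assumes "e \<in> all_pairs n"
  shows "card (touching n e) \<le> 2 * n"
proof -
  have e: "card e = 2" "finite e" using assms by (auto simp: all_pairs_eq intro: card_ge_0_finite)
  have "touching n e \<subseteq> (\<Union>x\<in>e. (\<lambda>y. {x, y}) ` {..<n})"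
    by (auto simp: touching_def all_pairs_def)
  then have "card (touching n e) \<le> card (\<Union>x\<in>e. (\<lambda>y. {x, y}) ` {..<n})"
    using e by (intro card_mono) auto
  also have "\<dots> \<le> (\<Sum>x\<in>e. card ((\<lambda>y. {x, y}) ` {..<n}))" by (rule card_UN_le[OF e(2)])
  also have "\<dots> \<le> (\<Sum>x\<in>e. n)" by (intro sum_mono order_trans[OF card_image_le]) auto
  finally show ?thesis using e by simp
qed

text \<open>A pair meeting two disjoint pairs joins an endpoint of one to an endpoint of the other.
  Hence the isolation of two disjoint edges is almost independent.\<close>

lemma card_touching_Int_le:
  assumes "e \<in> all_pairs n" "e' \<in> all_pairs n" "e \<inter> e' = {}"
  shows "card (touching n e \<inter> touching n e') \<le> 4"
proof -
  have e: "card e = 2" "finite e" "card e' = 2" "finite e'"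
    using assms by (auto simp: all_pairs_eq intro: card_ge_0_finite)
  have "touching n e \<inter> touching n e' \<subseteq> (\<lambda>(x, y). {x, y}) ` (e \<times> e')"
  proof
    fix f assume f: "f \<in> touching n e \<inter> touching n e'"
    then obtain x y where xy: "x \<in> f" "x \<in> e" "y \<in> f" "y \<in> e'" by (auto simp: touching_def)
    then have "x \<noteq> y" using assms(3) by auto
    moreover obtain u v where "f = {u, v}" using f by (auto simp: touching_def all_pairs_def)
    ultimately have "f = {x, y}" using xy by auto
    then show "f \<in> (\<lambda>(x, y). {x, y}) ` (e \<times> e')" using xy by auto
  qed
  then have "card (touching n e \<inter> touching n e') \<le> card ((\<lambda>(x, y). {x, y}) ` (e \<times> e'))"
    using e by (intro card_mono) auto
  also have "\<dots> \<le> card (e \<times> e')" using e by (intro card_image_le) auto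
  finally show ?thesis using e by (simp add: card_cartesian_product)
qed

text \<open>Let \<open>M\<close> be the expected number of isolated edges. In the second moment the
  diagonal gives \<open>M\<close>, distinct pairs sharing a vertex give 0, and disjoint ones exceed
  independence by at most \<open>1 / (1 - p) ^ 4\<close>, from at most four common touching pairs.
  Dividing the variance by the square of \<open>M\<close> gives the bound with \<open>M\<close>, and
  \<open>\<mu>\<close> is a lower bound for \<open>M\<close>.\<close>

lemma no_isolated_edge_bound:
  assumes p: "0 < p" "p < 1" and n: "n \<ge> 2"
  defines "\<mu> \<equiv> real (n choose 2) * p * (1 - p) ^ (2 * n)"
  shows "gnp_prob n p (\<lambda>E. \<not> (\<exists>e. isolated_edge E e)) \<le> 1 / \<mu> + 1 / (1 - p) ^ 4 - 1"
proof -
  let ?A = "all_pairs n" and ?B = "touching n"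
  define ev where "ev = subset_expectation ?A p"
  have finA: "finite ?A" by (rule finite_all_pairs)
  have p': "0 \<le> p" "p \<le> 1" using p by auto
  define X :: "nat set set \<Rightarrow> real" where "X E = (\<Sum>e\<in>?A. of_bool (isolated_edge E e))" for E
  define P where "P e = p * (1 - p) ^ card (?B e)" for e
  define P2 where "P2 e e' = ev (\<lambda>E. of_bool (isolated_edge E e) * of_bool (isolated_edge E e'))" for e e'
  define M where "M = (\<Sum>e\<in>?A. P e)"
  have ev1: "ev (\<lambda>E. of_bool (isolated_edge E e)) = P e" if e: "e \<in> ?A" for e
  proof -
    have "ev (\<lambda>E. of_bool (isolated_edge E e)) = ev (\<lambda>E. of_bool ({e} \<subseteq> E \<and> E \<inter> ?B e = {}))"
      unfolding ev_def by (intro subset_expectation_cong) (simp only: isolated_edge_iff)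
    also have "\<dots> = p ^ card {e} * (1 - p) ^ card (?B e)"
      unfolding ev_def using e finA by (intro subset_expectation_cylinder) (auto simp: touching_def)
    finally show ?thesis by (simp add: P_def)
  qed
  have P2_same: "P2 e e = P e" if "e \<in> ?A" for e
  proof -
    have "P2 e e = ev (\<lambda>E. of_bool (isolated_edge E e))"
      unfolding P2_def by (simp flip: of_bool_conj)
    then show ?thesis using ev1[OF that] by simp
  qed
  have P2_other: "P2 e e' \<le> P e * P e' / (1 - p) ^ 4" if e: "e \<in> ?A" "e' \<in> ?A" "e \<noteq> e'" for e e'
  proof (cases "e \<inter> e' = {}")
    case False
    then have "e' \<inter> e \<noteq> {}" by blast
    then have not_both: "\<not> (isolated_edge E e \<and> isolated_edge E e')" for E
      using e(3) unfolding isolated_edge_def by metis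
    then have "P2 e e' = ev (\<lambda>_. 0)"
      unfolding P2_def ev_def of_bool_conj[symmetric]
      by (intro subset_expectation_cong) (simp only: not_both of_bool_eq)
    then have "P2 e e' = 0" by (simp add: ev_def subset_expectation_const finA)
    then show ?thesis using p by (simp add: P_def)
  next
    case True
    have nonemp: "e \<noteq> {}" "e' \<noteq> {}" using e by (auto simp: all_pairs_def)
    have "P2 e e' = ev (\<lambda>E. of_bool ({e, e'} \<subseteq> E \<and> E \<inter> (?B e \<union> ?B e') = {}))"
      unfolding ev_def P2_def of_bool_conj[symmetric]
      by (intro subset_expectation_cong arg_cong[where f = of_bool]) (auto simp: isolated_edge_iff)
    also have "\<dots> = p ^ card {e, e'} * (1 - p) ^ card (?B e \<union> ?B e')"
      unfolding ev_def using e finA True nonemp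
      by (intro subset_expectation_cylinder) (auto simp: touching_def)
    also have "\<dots> = p\<^sup>2 * (1 - p) ^ card (?B e \<union> ?B e')"
      using e(3) by (simp add: power2_eq_square)
    finally have P2: "P2 e e' = p\<^sup>2 * (1 - p) ^ card (?B e \<union> ?B e')" .
    have "card (?B e) + card (?B e') = card (?B e \<union> ?B e') + card (?B e \<inter> ?B e')"
      by (intro card_Un_Int finite_touching)
    also have "\<dots> \<le> card (?B e \<union> ?B e') + 4"
      using card_touching_Int_le[OF e(1,2) True] by simp
    finally have "(1 - p) ^ (card (?B e \<union> ?B e') + 4) \<le> (1 - p) ^ (card (?B e) + card (?B e'))"
      using p by (intro power_decreasing) auto
    then have "p\<^sup>2 * (1 - p) ^ (card (?B e \<union> ?B e') + 4) \<le> p\<^sup>2 * (1 - p) ^ (card (?B e) + card (?B e'))"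
      by (intro mult_left_mono) auto
    then have "P2 e e' * (1 - p) ^ 4 \<le> P e * P e'"
      by (simp add: P2 P_def power_add power2_eq_square algebra_simps)
    then show ?thesis using p by (simp add: pos_le_divide_eq)
  qed
  have Pnn: "P e \<ge> 0" for e using p by (simp add: P_def)
  have evX: "ev X = M"
    unfolding X_def[abs_def] M_def ev_def subset_expectation_sum
    by (intro sum.cong) (auto simp: ev1[unfolded ev_def])
  have "ev (\<lambda>E. (X E)\<^sup>2) = (\<Sum>e\<in>?A. \<Sum>e'\<in>?A. P2 e e')"
    unfolding X_def power2_eq_square sum_product ev_def P2_def subset_expectation_sum ..
  also have "\<dots> \<le> (\<Sum>e\<in>?A. P e + (\<Sum>e'\<in>?A. P e * P e' / (1 - p) ^ 4))"
  proof (rule sum_mono)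
    fix e assume e: "e \<in> ?A"
    have "(\<Sum>e'\<in>?A. P2 e e') = P2 e e + (\<Sum>e'\<in>?A - {e}. P2 e e')"
      using finA e by (rule sum.remove)
    also have "\<dots> \<le> P e + (\<Sum>e'\<in>?A - {e}. P e * P e' / (1 - p) ^ 4)"
      using P2_same[OF e] P2_other[OF e] by (intro add_mono sum_mono) auto
    \<comment> \<open>Restoring the diagonal term completes the double sum to a multiple of the
      square of \<open>M\<close>.\<close>
    also have "\<dots> \<le> P e + (\<Sum>e'\<in>?A. P e * P e' / (1 - p) ^ 4)"
      using finA Pnn p by (intro add_left_mono sum_mono2) auto
    finally show "(\<Sum>e'\<in>?A. P2 e e') \<le> P e + (\<Sum>e'\<in>?A. P e * P e' / (1 - p) ^ 4)" .
  qed
  also have "\<dots> = M + M\<^sup>2 / (1 - p) ^ 4"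
    by (simp add: M_def sum.distrib power2_eq_square sum_product sum_divide_distrib)
  finally have evX2: "ev (\<lambda>E. (X E)\<^sup>2) \<le> M + M\<^sup>2 / (1 - p) ^ 4" .
  have "card ?A = n choose 2" unfolding all_pairs_eq by (simp add: n_subsets)
  then have "\<mu> = (\<Sum>e\<in>?A. p * (1 - p) ^ (2 * n))" by (simp add: \<mu>_def)
  also have "\<dots> \<le> M"
    unfolding M_def P_def using p card_touching_le
    by (intro sum_mono mult_left_mono power_decreasing) auto
  finally have \<mu>M: "\<mu> \<le> M" .
  have \<mu>: "\<mu> > 0" using p n by (simp add: \<mu>_def zero_less_binomial)
  then have M: "M > 0" using \<mu>M by linarith
  have "gnp_prob n p (\<lambda>E. \<not> (\<exists>e. isolated_edge E e)) \<le> ev (\<lambda>E. of_bool (X E = 0))"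
    unfolding gnp_prob_eq ev_def
    by (intro subset_expectation_mono p') (auto simp: X_def)
  also have "M\<^sup>2 * ev (\<lambda>E. of_bool (X E = 0)) \<le> ev (\<lambda>E. (X E)\<^sup>2) - M\<^sup>2"
    using second_moment[OF finA p', of X] evX by (simp add: ev_def)
  then have "M\<^sup>2 * ev (\<lambda>E. of_bool (X E = 0)) \<le> M\<^sup>2 * (1 / M + 1 / (1 - p) ^ 4 - 1)"
    using evX2 M by (simp add: algebra_simps power2_eq_square)
  then have "ev (\<lambda>E. of_bool (X E = 0)) \<le> 1 / M + 1 / (1 - p) ^ 4 - 1"
    using M by simp
  also have "\<dots> \<le> 1 / \<mu> + 1 / (1 - p) ^ 4 - 1"
    using \<mu> \<mu>M by (simp add: frac_le)
  finally show ?thesis by simp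
qed

text \<open>For \<open>p = c / n\<close> the quantity \<open>\<mu>\<close> is
  \<open>c * (n - 1) / 2\<close> times a factor tending to \<open>exp (- 2 * c)\<close>, so it tends
  to infinity, while \<open>(1 - p) ^ 4\<close> tends to 1.\<close>

lemma no_isolated_edge_tendsto_0:
  assumes c: "0 < c"
  shows "(\<lambda>n. gnp_prob n (c / real n) (\<lambda>E. \<not> (\<exists>e. isolated_edge E e))) \<longlonglongrightarrow> 0"
proof -
  define p where "p n = c / real n" for n
  define \<mu> where "\<mu> n = real (n choose 2) * p n * (1 - p n) ^ (2 * n)" for n
  have p0: "p \<longlonglongrightarrow> 0" unfolding p_def by real_asymp
  have "(\<lambda>n. (1 + (- c) / real n) ^ n) \<longlonglongrightarrow> exp (- c)" by (rule tendsto_exp_limit_sequentially)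
  then have "(\<lambda>n. ((1 + (- c) / real n) ^ n)\<^sup>2) \<longlonglongrightarrow> (exp (- c))\<^sup>2" by (rule tendsto_power)
  then have e: "(\<lambda>n. (1 - p n) ^ (2 * n)) \<longlonglongrightarrow> (exp (- c))\<^sup>2"
    by (simp add: p_def mult.commute[of 2] power_mult)
  have "filterlim (\<lambda>n::nat. c * (real n - 1) / 2) at_top sequentially"
    using c by real_asymp
  then have "filterlim (\<lambda>n. (c * (real n - 1) / 2) * (1 - p n) ^ (2 * n)) at_top sequentially"
    using e by (rule filterlim_at_top_mult_tendsto_pos[rotated 2, OF _ _ ]) simp
  moreover have "\<forall>\<^sub>F n in sequentially. (c * (real n - 1) / 2) * (1 - p n) ^ (2 * n) = \<mu> n"
  proof (rule eventually_sequentiallyI[of 2])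
    fix n :: nat assume n: "n \<ge> 2"
    have "real (n choose 2) = real n * (real n - 1) / 2"
      using n by (simp add: binomial_gbinomial gbinomial_pochhammer' numeral_2_eq_2 pochhammer_Suc)
    then have "real (n choose 2) * p n = real n * (real n - 1) / 2 * (c / real n)" by (simp only: p_def)
    also have "\<dots> = c * (real n - 1) / 2" using n by simp
    finally have "real (n choose 2) * p n = c * (real n - 1) / 2" .
    then show "(c * (real n - 1) / 2) * (1 - p n) ^ (2 * n) = \<mu> n"
      by (simp add: \<mu>_def)
  qed
  ultimately have "filterlim \<mu> at_top sequentially" by (rule filterlim_mono_eventually[OF _ order_refl order_refl])
  then have "(\<lambda>n. 1 / \<mu> n) \<longlonglongrightarrow> 0" by (intro tendsto_divide_0[OF tendsto_const] filterlim_at_top_imp_at_infinity)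
  moreover have "(\<lambda>n. 1 / (1 - p n) ^ 4) \<longlonglongrightarrow> 1 / (1 - 0) ^ 4"
    by (intro tendsto_intros p0) auto
  ultimately have "(\<lambda>n. 1 / \<mu> n + 1 / (1 - p n) ^ 4 - 1) \<longlonglongrightarrow> 0 + 1 / (1 - 0) ^ 4 - 1"
    by (intro tendsto_add tendsto_diff tendsto_const)
  then have lim: "(\<lambda>n. 1 / \<mu> n + 1 / (1 - p n) ^ 4 - 1) \<longlonglongrightarrow> 0" by simp
  have "\<forall>\<^sub>F n in sequentially. p n < 1" using p0 by (rule order_tendstoD) simp
  then have ev: "\<forall>\<^sub>F n in sequentially. 2 \<le> n \<and> 0 < p n \<and> p n < 1"
    using eventually_ge_at_top[of 2] by eventually_elim (use c in \<open>auto simp: p_def\<close>)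
  show ?thesis
  proof (rule tendsto_sandwich[OF _ _ tendsto_const lim])
    show "\<forall>\<^sub>F n in sequentially. 0 \<le> gnp_prob n (c / real n) (\<lambda>E. \<not> (\<exists>e. isolated_edge E e))"
      using ev by eventually_elim (auto intro!: gnp_prob_nonneg simp: p_def)
    show "\<forall>\<^sub>F n in sequentially. gnp_prob n (c / real n) (\<lambda>E. \<not> (\<exists>e. isolated_edge E e))
        \<le> 1 / \<mu> n + 1 / (1 - p n) ^ 4 - 1"
      using ev
    proof eventually_elim
      case (elim n)
      then show ?case using no_isolated_edge_bound[of "p n" n] by (simp only: \<mu>_def p_def)
    qed
  qed
qed

section \<open>Monotonicity and the range below the threshold\<close>

lemma Dmax_mono:
  assumes "n > 0" "E \<subseteq> E'"
  shows "Dmax n E \<le> Dmax n E'"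
proof -
  have setE: "{Min (deg_in E S ` S) | S. S \<subseteq> {0..<n} \<and> S \<noteq> {}}
      = (\<lambda>S. Min (deg_in E S ` S)) ` {S. S \<subseteq> {0..<n} \<and> S \<noteq> {}}" for E by auto
  have ne: "{S. S \<subseteq> {0..<n} \<and> S \<noteq> {}} \<noteq> {}" using assms(1) by (auto intro!: exI[of _ "{0}"])
  show ?thesis
    unfolding Dmax_def setE
  proof (rule Max.boundedI)
    fix a assume "a \<in> (\<lambda>S. Min (deg_in E S ` S)) ` {S. S \<subseteq> {0..<n} \<and> S \<noteq> {}}"
    then obtain S where S: "S \<subseteq> {0..<n}" "S \<noteq> {}" and a: "a = Min (deg_in E S ` S)" by auto
    have fin: "finite S" using S(1) finite_subset by blast
    have "a \<le> deg_in E' S v" if v: "v \<in> S" for v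
    proof -
      have "a \<le> deg_in E S v" unfolding a using fin v by (intro Min_le) auto
      also have "\<dots> \<le> deg_in E' S v"
        unfolding deg_in_def using fin assms(2) by (intro card_mono) auto
      finally show ?thesis .
    qed
    then have "a \<le> Min (deg_in E' S ` S)" using fin S(2) by (intro Min.boundedI) auto
    also have "\<dots> \<le> Max ((\<lambda>S. Min (deg_in E' S ` S)) ` {S. S \<subseteq> {0..<n} \<and> S \<noteq> {}})"
      using S by (intro Max_ge) auto
    finally show "a \<le> Max ((\<lambda>S. Min (deg_in E' S ` S)) ` {S. S \<subseteq> {0..<n} \<and> S \<noteq> {}})" .
  qed (use ne in auto)
qed

text \<open>\<open>c_thr k\<close> is only a supremum, so the limit is known at some
  \<open>c'\<close> above \<open>c\<close> and is carried down by monotonicity in the edge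
  probability, once \<open>n\<close> is large enough for \<open>c' / n <= 1\<close>.\<close>

lemma Dmax_tendsto_0:
  assumes c: "0 < c" "ereal c < c_thr k"
  shows "(\<lambda>n. gnp_prob n (c / real n) (\<lambda>E. Dmax n E \<ge> k)) \<longlonglongrightarrow> 0"
proof -
  obtain c' where c': "c < c'" and lim: "(\<lambda>n. gnp_prob n (c' / real n) (\<lambda>E. Dmax n E \<ge> k)) \<longlonglongrightarrow> 0"
    using c(2) unfolding c_thr_def less_Sup_iff by auto
  obtain N :: nat where N: "c' \<le> real N" using real_arch_simple by blast
  show ?thesis
  proof (rule tendsto_sandwich[OF _ _ tendsto_const lim])
    show "\<forall>\<^sub>F n in sequentially. 0 \<le> gnp_prob n (c / real n) (\<lambda>E. Dmax n E \<ge> k)"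
    proof (rule eventually_sequentiallyI[of "Suc N"])
      fix n assume "Suc N \<le> n"
      then show "0 \<le> gnp_prob n (c / real n) (\<lambda>E. Dmax n E \<ge> k)"
        using c N c' by (intro gnp_prob_nonneg) auto
    qed
    show "\<forall>\<^sub>F n in sequentially. gnp_prob n (c / real n) (\<lambda>E. Dmax n E \<ge> k)
        \<le> gnp_prob n (c' / real n) (\<lambda>E. Dmax n E \<ge> k)"
    proof (rule eventually_sequentiallyI[of "Suc N"])
      fix n assume n: "Suc N \<le> n"
      have "of_bool (k \<le> Dmax n E) \<le> (of_bool (k \<le> Dmax n E') :: real)" if "E \<subseteq> E'" for E E'
        using Dmax_mono[OF _ that, of n] n by auto
      then show "gnp_prob n (c / real n) (\<lambda>E. Dmax n E \<ge> k) \<le> gnp_prob n (c' / real n) (\<lambda>E. Dmax n E \<ge> k)"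
        unfolding gnp_prob_eq using c N c' n
        by (intro subset_expectation_mono_prob) (auto simp: finite_all_pairs divide_right_mono)
    qed
  qed
qed

section \<open>Combination of both bounds with high probability\<close>

theorem theorem5p2:
  fixes k m :: nat and c :: real
  assumes "k \<ge> 2" and "0 < c" and "ereal c < c_thr (k + 1)" and "m \<ge> 4"
  shows "(\<lambda>n. gnp_prob n (c / real n)
            (\<lambda>E. ereal (real_of_int (int m - int k - 2)) \<le> Mconn n E m
                 \<and> Mconn n E m \<le> ereal (real_of_int (int m - 3)))) \<longlonglongrightarrow> 1"
proof -
  let ?good = "\<lambda>n E. ereal (real_of_int (int m - int k - 2)) \<le> Mconn n E m
                 \<and> Mconn n E m \<le> ereal (real_of_int (int m - 3))"
  let ?D = "\<lambda>n. gnp_prob n (c / real n) (\<lambda>E. Dmax n E \<ge> k + 1)"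
  let ?I = "\<lambda>n. gnp_prob n (c / real n) (\<lambda>E. \<not> (\<exists>e. isolated_edge E e))"
  have "(\<lambda>n. 1 - ?D n - ?I n) \<longlonglongrightarrow> 1 - 0 - 0"
    by (intro tendsto_diff tendsto_const Dmax_tendsto_0 no_isolated_edge_tendsto_0 assms)
  then have lim: "(\<lambda>n. 1 - ?D n - ?I n) \<longlonglongrightarrow> 1" by simp
  \<comment> \<open>Beyond \<open>N\<close> the quotient \<open>c / n\<close> is a genuine
    probability; the finitely many other \<open>n\<close> do not affect the limit.\<close>
  obtain N :: nat where N: "c \<le> real N" using real_arch_simple by blast
  have p: "0 \<le> c / real n" "c / real n \<le> 1" if "Suc N \<le> n" for n
    using assms(2) N that by auto
  \<comment> \<open>Off the two rare events both bounds hold for every graph deterministically,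
    which leaves the good event a probability of at least \<open>1 - ?D n - ?I n\<close>.\<close>
  have cover: "?good n E \<or> Dmax n E \<ge> k + 1 \<or> \<not> (\<exists>e. isolated_edge E e)" if E: "E \<subseteq> all_pairs n" for n E
  proof (cases "Dmax n E \<ge> k + 1 \<or> \<not> (\<exists>e. isolated_edge E e)")
    case False
    then obtain e where e: "isolated_edge E e" and D: "Dmax n E \<le> k" by auto
    then have "e \<in> all_pairs n" using E by (auto simp: isolated_edge_def)
    then obtain a b where ab: "a < n" "b < n" "a \<noteq> b" "e = {a, b}" by (auto simp: all_pairs_def)
    have abE: "{a, b} \<in> E" and iso: "\<And>e'. e' \<in> E \<Longrightarrow> e' \<inter> {a, b} \<noteq> {} \<Longrightarrow> e' = {a, b}"
      using e unfolding isolated_edge_def ab(4) by blast+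
    have "Mconn n E m \<le> ereal (real_of_int (int m - 3))"
    proof (rule Mconn_le[OF _ ab(1-3) abE])
      show "2 \<le> m" using assms(4) by simp
    qed (rule iso)
    then show ?thesis using Mconn_ge[OF E D] by blast
  qed blast
  show ?thesis
  proof (rule tendsto_sandwich[OF _ _ lim tendsto_const])
    show "\<forall>\<^sub>F n in sequentially. 1 - ?D n - ?I n \<le> gnp_prob n (c / real n) (?good n)"
    proof (rule eventually_sequentiallyI[of "Suc N"])
      fix n assume "Suc N \<le> n"
      then have "1 \<le> gnp_prob n (c / real n) (?good n) + ?D n + ?I n"
        by (intro gnp_prob_union_bound p cover)
      then show "1 - ?D n - ?I n \<le> gnp_prob n (c / real n) (?good n)" by linarith
    qed
    show "\<forall>\<^sub>F n in sequentially. gnp_prob n (c / real n) (?good n) \<le> 1"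
      by (rule eventually_sequentiallyI[of "Suc N"]) (intro gnp_prob_le_1 p)
  qed
qed

end
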